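(* Let $\Omega\subset\mathbb{C}^n$ be a bounded pseudoconvex domain with $C^2$ smooth boundary, let $w\in\partial\Omega$, and let $\kappa_1,\dots,\kappa_{2n-1}$ be the principal curvatures of $\partial\Omega$ at $w$. Then one can choose $2n-2$ out of the $2n-1$ principal curvatures, i.e. there is an index $j\in\{1,\dots,2n-1\}$, so that the sum $$\kappa_1+\cdots+\kappa_{j-1}+\kappa_{j+1}+\cdots+\kappa_{2n-1}$$ is non-negative; moreover this sum is positive unless $\partial\Omega$ is Levi flat at $w$. Furthermore, at least $n-1$ of the principal curvatures $\kappa_1,\dots,\kappa_{2n-1}$ are non-negative, and at least $n-1$ of them are positive if $\partial\Omega$ is strongly pseudoconvex at $w$.
   Context: $\mathbb{C}^n$ is identified with $\mathbb{R}^{2n}$ with its Euclidean structure. Let $\nu(w)$ be the inward unit normal to $\partial\Omega$ at $w$. The principal curvatures of $\partial\Omega$ at $w$ are the eigenvalues (with multiplicity) of the second fundamental form $\mathrm{II}(w)(X,Y)=-\langle d\nu(w)(X),Y\rangle$ on the $(2n-1)$-dimensional real tangent space $T_w\partial\Omega$ with the inner product induced from $\mathbb{R}^{2n}$; with this sign convention the unit ball has all principal curvatures equal to $1$. For a domain with $C^2$ boundary, pseudoconvexity is Levi pseudoconvexity: for each $p\in\partial\Omega$ and each $C^2$ local defining function $\rho$ of $\partial\Omega$ near $p$ ($\rho<0$ in $\Omega$, $\nabla\rho\ne0$ on $\partial\Omega$), the Levi form $$\mathcal{L}(\rho(p))(X,X)=\sum_{j,k=1}^n\frac{\partial^2\rho}{\partial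 z_j\partial\bar z_k}(p)X_j\overline{X_k}$$ is $\ge0$ for every complex tangent vector $X=\sum_j X_j\frac{\partial}{\partial z_j}$ at $p$, i.e. every $X$ with $\sum_j\frac{\partial\rho}{\partial z_j}(p)X_j=0$. $\partial\Omega$ is Levi flat at $w$ if the Levi form at $w$ vanishes identically on complex tangent vectors, and strongly pseudoconvex at $w$ if the Levi form at $w$ is positive on all nonzero complex tangent vectors. *)

theory Defs
  imports "HOL-Analysis.Analysis"
begin

text \<open>
  Complex n-space is \<^typ>\<open>complex ^ 'n\<close>; its library inner product (over the reals) is the
  Euclidean inner product of real 2n-space.
\<close>

section \<open>Domains with twice continuously differentiable boundary\<close>

text \<open>\<open>g\<close> is the gradient and \<open>H\<close> the Hessian, the latter as an operator.\<close>

definition C2_on :: "'a::euclidean_space set \<Rightarrow> ('a \<Rightarrow> real) \<Rightarrow> bool" where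
  "C2_on U \<rho> \<longleftrightarrow>
     (\<exists>(g :: 'a \<Rightarrow> 'a) (H :: 'a \<Rightarrow> 'a \<Rightarrow>\<^sub>L 'a).
        (\<forall>x\<in>U. GDERIV \<rho> x :> g x) \<and>
        (\<forall>x\<in>U. (g has_derivative blinfun_apply (H x)) (at x)) \<and>
        continuous_on U H)"

definition local_defining_function ::
  "'a::euclidean_space set \<Rightarrow> 'a \<Rightarrow> 'a set \<Rightarrow> ('a \<Rightarrow> real) \<Rightarrow> bool" where
  "local_defining_function \<Omega> p U \<rho> \<longleftrightarrow>
     open U \<and> p \<in> U \<and> C2_on U \<rho> \<and>
     \<Omega> \<inter> U = {z \<in> U. \<rho> z < 0} \<and>
     frontier \<Omega> \<inter> U = {z \<in> U. \<rho> z = 0} \<and>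
     (\<forall>z \<in> frontier \<Omega> \<inter> U. \<not> GDERIV \<rho> z :> 0)"

definition C2_boundary :: "'a::euclidean_space set \<Rightarrow> bool" where
  "C2_boundary \<Omega> \<longleftrightarrow> (\<forall>p \<in> frontier \<Omega>. \<exists>U \<rho>. local_defining_function \<Omega> p U \<rho>)"

section \<open>Principal curvatures\<close>

text \<open>
  Any two local defining functions at \<open>w\<close> have positively proportional gradients there, so
  this is well defined; the gradient points out of \<open>\<Omega>\<close>, whence the sign.
\<close>

definition inward_unit_normal :: "'a::euclidean_space set \<Rightarrow> 'a \<Rightarrow> 'a" where
  "inward_unit_normal \<Omega> w =
     (THE v. \<exists>U \<rho> g. local_defining_function \<Omega> w U \<rho> \<and> GDERIV \<rho> w :> g \<and> v = - (g /\<^sub>R norm g))"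

definition boundary_tangent_space :: "'a::euclidean_space set \<Rightarrow> 'a \<Rightarrow> 'a set" where
  "boundary_tangent_space \<Omega> w = {X. X \<bullet> inward_unit_normal \<Omega> w = 0}"

text \<open>
  The normal field lives on the boundary only, so its differential is taken within the boundary.
  The Frechet derivative within \<open>frontier \<Omega>\<close> is determined exactly on tangent vectors; hence
  \<open>X\<close> is meant to range over \<^term>\<open>boundary_tangent_space \<Omega> w\<close>.
\<close>

definition second_fundamental_form :: "'a::euclidean_space set \<Rightarrow> 'a \<Rightarrow> 'a \<Rightarrow> 'a \<Rightarrow> real" where
  "second_fundamental_form \<Omega> w X Y =
     - (frechet_derivative (inward_unit_normal \<Omega>) (at w within frontier \<Omega>) X \<bullet> Y)"

definition curvature_eigenspace :: "'a::euclidean_space set \<Rightarrow> 'a \<Rightarrow> real \<Rightarrow> 'a set" where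
  "curvature_eigenspace \<Omega> w c =
     {X \<in> boundary_tangent_space \<Omega> w.
        \<forall>Y \<in> boundary_tangent_space \<Omega> w. second_fundamental_form \<Omega> w X Y = c * (X \<bullet> Y)}"

text \<open>
  \<open>\<kappa> 1, \<dots>, \<kappa> (DIM('a) - 1)\<close> enumerates the eigenvalues with multiplicity: each real number
  occurs as often as the dimension of its eigenspace, which for the symmetric second
  fundamental form is the algebraic multiplicity.
\<close>

definition principal_curvatures :: "'a::euclidean_space set \<Rightarrow> 'a \<Rightarrow> (nat \<Rightarrow> real) \<Rightarrow> bool" where
  "principal_curvatures \<Omega> w \<kappa> \<longleftrightarrow>
     (\<forall>c. card {i \<in> {1..DIM('a) - 1}. \<kappa> i = c} = dim (curvature_eigenspace \<Omega> w c))"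

section \<open>The Levi form\<close>

definition directional_deriv ::
  "'a::real_normed_vector \<Rightarrow> ('a \<Rightarrow> complex) \<Rightarrow> 'a \<Rightarrow> complex" where
  "directional_deriv v f p = vector_derivative (\<lambda>t::real. f (p + t *\<^sub>R v)) (at 0)"

text \<open>
  With \<open>z\<^sub>j = x\<^sub>j + \<i> y\<^sub>j\<close>, the coordinate directions of \<open>x\<^sub>j\<close> and \<open>y\<^sub>j\<close> are
  \<^term>\<open>axis j (1::complex)\<close> and \<^term>\<open>axis j \<i>\<close>.
\<close>

definition wirtinger_z ::
  "'n::finite \<Rightarrow> (complex ^ 'n \<Rightarrow> complex) \<Rightarrow> complex ^ 'n \<Rightarrow> complex" where
  "wirtinger_z j f p =
     (directional_deriv (axis j 1) f p - \<i> * directional_deriv (axis j \<i>) f p) / 2"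

definition wirtinger_zbar ::
  "'n::finite \<Rightarrow> (complex ^ 'n \<Rightarrow> complex) \<Rightarrow> complex ^ 'n \<Rightarrow> complex" where
  "wirtinger_zbar j f p =
     (directional_deriv (axis j 1) f p + \<i> * directional_deriv (axis j \<i>) f p) / 2"

text \<open>
  The double sum is a Hermitian form evaluated at \<open>(X, X)\<close>, hence real; \<^const>\<open>Re\<close> only
  changes the type.
\<close>

definition levi_form ::
  "(complex ^ 'n::finite \<Rightarrow> real) \<Rightarrow> complex ^ 'n \<Rightarrow> complex ^ 'n \<Rightarrow> real" where
  "levi_form \<rho> p X =
     Re (\<Sum>j\<in>UNIV. \<Sum>k\<in>UNIV.
           wirtinger_z j (wirtinger_zbar k (\<lambda>z. of_real (\<rho> z))) p * X $ j * cnj (X $ k))"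

definition complex_tangent ::
  "(complex ^ 'n::finite \<Rightarrow> real) \<Rightarrow> complex ^ 'n \<Rightarrow> complex ^ 'n \<Rightarrow> bool" where
  "complex_tangent \<rho> p X \<longleftrightarrow>
     (\<Sum>j\<in>UNIV. wirtinger_z j (\<lambda>z. of_real (\<rho> z)) p * X $ j) = 0"

definition levi_pseudoconvex :: "(complex ^ 'n::finite) set \<Rightarrow> bool" where
  "levi_pseudoconvex \<Omega> \<longleftrightarrow>
     (\<forall>p \<in> frontier \<Omega>. \<forall>U \<rho>. local_defining_function \<Omega> p U \<rho> \<longrightarrow>
        (\<forall>X. complex_tangent \<rho> p X \<longrightarrow> 0 \<le> levi_form \<rho> p X))"

definition levi_flat_at :: "(complex ^ 'n::finite) set \<Rightarrow> complex ^ 'n \<Rightarrow> bool" where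
  "levi_flat_at \<Omega> w \<longleftrightarrow>
     (\<forall>U \<rho>. local_defining_function \<Omega> w U \<rho> \<longrightarrow>
        (\<forall>X. complex_tangent \<rho> w X \<longrightarrow> levi_form \<rho> w X = 0))"

definition strongly_pseudoconvex_at :: "(complex ^ 'n::finite) set \<Rightarrow> complex ^ 'n \<Rightarrow> bool" where
  "strongly_pseudoconvex_at \<Omega> w \<longleftrightarrow>
     (\<forall>U \<rho>. local_defining_function \<Omega> w U \<rho> \<longrightarrow>
        (\<forall>X. complex_tangent \<rho> w X \<and> X \<noteq> 0 \<longrightarrow> 0 < levi_form \<rho> w X))"

end

theory Submission
  imports Defs
begin

text \<open>
  For a defining function with gradient \<open>g\<close> and Hessian \<open>H\<close> at \<open>w\<close>, the second fundamental form
  is \<open>q X = (H X \<bullet> X) / norm g\<close> on \<open>T = {X. X \<bullet> g = 0}\<close>, and the Levi form of \<open>X\<close> is a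
  positive multiple of \<open>q X + q (\<i> X)\<close>. Let \<open>e i\<close> be an orthonormal eigenbasis of \<open>T\<close> and
  \<open>u = \<i> g / norm g\<close>. The complex tangent space is the orthogonal complement of \<open>u\<close> in \<open>T\<close>, so
  the trace of \<open>q\<close> on it is \<open>(\<Sum>i. \<kappa> i) - q u\<close>. By pseudoconvexity this is nonnegative; on the
  other hand \<open>q u\<close> is an average of the \<open>\<kappa> i\<close>, so that dropping the least \<open>\<kappa> j\<close> does at least as
  well. If more than \<open>n\<close> of the \<open>\<kappa> i\<close> were negative, the span \<open>W\<close> of their eigenvectors would
  meet \<open>\<i> W\<close> for dimension reasons, and \<open>q X + q (\<i> X) < 0\<close> for some complex tangent \<open>X\<close>.
\<close>

section \<open>Hessians and level sets\<close>

text \<open>The mean value theorem in the direction \<open>v\<close> turns the second difference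
  into a difference of two gradients, and differentiability of \<open>g\<close> at \<open>p\<close>
  evaluates both. The point of the estimate is that the second difference is symmetric in
  \<open>u\<close> and \<open>v\<close>.\<close>

lemma second_difference_estimate:
  fixes \<rho> :: "'a::euclidean_space \<Rightarrow> real"
  assumes "open U" "p \<in> U" and g: "\<And>x. x \<in> U \<Longrightarrow> GDERIV \<rho> x :> g x"
    and H: "(g has_derivative H) (at p)" and "e > 0"
  shows "\<forall>\<^sub>F t in at_right 0.
    \<bar>\<rho> (p + t *\<^sub>R u + t *\<^sub>R v) - \<rho> (p + t *\<^sub>R u) - \<rho> (p + t *\<^sub>R v) + \<rho> p - t\<^sup>2 * (H u \<bullet> v)\<bar> \<le> e * t\<^sup>2"
proof -
  interpret H: bounded_linear H by (rule has_derivative_bounded_linear[OF H])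
  \<comment> \<open>\<open>t * M\<close> bounds every \<open>a u + b v\<close> with coefficients
    between 0 and \<open>t\<close>. The constant \<open>c\<close> makes the two remainders of the
    linearisation of \<open>g\<close>, each at most \<open>c * (t * M)\<close>, add up to
    \<open>e * t\<^sup>2\<close> after multiplication by \<open>t * M\<close>.\<close>
  define M where "M = norm u + norm v + 1"
  have M: "M > 0" "norm u \<le> M" "norm v \<le> M" "norm u + norm v \<le> M"
    unfolding M_def by (auto intro: add_nonneg_pos)
  define c where "c = e / (2 * M * M)"
  have c: "c > 0" using M assms(5) by (simp add: c_def)
  obtain d1 where d1: "d1 > 0" "\<And>y. norm (y - p) < d1 \<Longrightarrow> norm (g y - g p - H (y - p)) \<le> c * norm (y - p)"
    using H c unfolding has_derivative_at_alt by blast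
  obtain d2 where d2: "d2 > 0" "ball p d2 \<subseteq> U"
    using assms(1,2) open_contains_ball by blast
  define d where "d = min d1 d2 / M"
  have d: "d > 0" using d1 d2 M by (simp add: d_def)
  have est: "\<bar>\<rho> (p + t *\<^sub>R u + t *\<^sub>R v) - \<rho> (p + t *\<^sub>R u) - \<rho> (p + t *\<^sub>R v) + \<rho> p - t\<^sup>2 * (H u \<bullet> v)\<bar> \<le> e * t\<^sup>2"
    if t: "0 < t" "t < d" for t
  proof -
    have tM: "t * M < d1" "t * M < d2"
      using t M by (auto simp: d_def pos_less_divide_eq)
    have small: "norm (a *\<^sub>R u + b *\<^sub>R v) \<le> t * M" if "0 \<le> a" "a \<le> t" "0 \<le> b" "b \<le> t" for a b
    proof -
      have "norm (a *\<^sub>R u + b *\<^sub>R v) \<le> a * norm u + b * norm v"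
        using that norm_triangle_ineq[of "a *\<^sub>R u" "b *\<^sub>R v"] by simp
      also have "\<dots> \<le> t * norm u + t * norm v"
        using that by (intro add_mono mult_right_mono) auto
      also have "\<dots> \<le> t * M" using M t by (simp flip: distrib_left)
      finally show ?thesis .
    qed
    have inU: "p + a *\<^sub>R u + b *\<^sub>R v \<in> U" if "0 \<le> a" "a \<le> t" "0 \<le> b" "b \<le> t" for a b
    proof -
      have "dist (p + (a *\<^sub>R u + b *\<^sub>R v)) p \<le> t * M"
        using small[OF that] by (simp add: dist_norm)
      then have "p + (a *\<^sub>R u + b *\<^sub>R v) \<in> ball p d2" using tM by (simp add: dist_commute)
      then show ?thesis using d2 by (auto simp: add.assoc)
    qed
    \<comment> \<open>Written with \<open>0 *\<^sub>R u\<close> so that \<open>der\<close> covers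
      both terms, with \<open>a = t\<close> and \<open>a = 0\<close>.\<close>
    define f where "f s = \<rho> (p + t *\<^sub>R u + s *\<^sub>R v) - \<rho> (p + 0 *\<^sub>R u + s *\<^sub>R v)" for s
    have der: "((\<lambda>s. \<rho> (p + a *\<^sub>R u + s *\<^sub>R v)) has_real_derivative (v \<bullet> g (p + a *\<^sub>R u + s *\<^sub>R v))) (at s)"
      if "0 \<le> a" "a \<le> t" "0 \<le> s" "s \<le> t" for a s
    proof -
      have "(\<rho> has_derivative (\<lambda>h. h \<bullet> g (p + a *\<^sub>R u + s *\<^sub>R v))) (at (p + a *\<^sub>R u + s *\<^sub>R v))"
        using g[OF inU[OF that]] by (simp add: gderiv_def)
      moreover have "((\<lambda>s. p + a *\<^sub>R u + s *\<^sub>R v) has_derivative (\<lambda>h. h *\<^sub>R v)) (at s)"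
        by (auto intro!: derivative_eq_intros)
      ultimately have "((\<lambda>s. \<rho> (p + a *\<^sub>R u + s *\<^sub>R v)) has_derivative (\<lambda>h. (h *\<^sub>R v) \<bullet> g (p + a *\<^sub>R u + s *\<^sub>R v))) (at s)"
        using has_derivative_compose by fastforce
      then show ?thesis
        by (simp add: has_field_derivative_def mult.commute[of _ "v \<bullet> _"] cong: if_cong)
    qed
    have "\<exists>z>0. z < t \<and> f t - f 0 = (t - 0) * (v \<bullet> g (p + t *\<^sub>R u + z *\<^sub>R v) - v \<bullet> g (p + 0 *\<^sub>R u + z *\<^sub>R v))"
      unfolding f_def by (rule MVT2[OF t(1)]) (rule DERIV_diff; rule der; use t in auto)
    then obtain z where z: "0 < z" "z < t" and fz: "f t - f 0 = t * (v \<bullet> g (p + t *\<^sub>R u + z *\<^sub>R v) - v \<bullet> g (p + z *\<^sub>R v))"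
      by auto
    define E where "E h = g (p + h) - g p - H h" for h
    have E: "norm (E h) \<le> c * (t * M)" if "norm h \<le> t * M" for h
    proof -
      have "norm (E h) \<le> c * norm h"
        using d1(2)[of "p + h"] that tM by (simp add: E_def)
      also have "\<dots> \<le> c * (t * M)" using that c by (intro mult_left_mono) auto
      finally show ?thesis .
    qed
    have s1: "norm (t *\<^sub>R u + z *\<^sub>R v) \<le> t * M" "norm (z *\<^sub>R v) \<le> t * M"
      using small[of t z] small[of 0 z] z t by auto
    \<comment> \<open>By linearity \<open>H\<close> contributes exactly \<open>t * H u\<close> to
      the difference of the gradients, so the unknown intermediate \<open>z\<close> survives only in
      the remainders \<open>E\<close>.\<close>
    have "f t - f 0 - t\<^sup>2 * (H u \<bullet> v) = t * (v \<bullet> (E (t *\<^sub>R u + z *\<^sub>R v) - E (z *\<^sub>R v)))"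
      unfolding fz E_def
      by (simp add: H.add H.scaleR inner_diff_right inner_add_right algebra_simps power2_eq_square inner_commute)
    also have "\<bar>\<dots>\<bar> \<le> t * (norm v * (norm (E (t *\<^sub>R u + z *\<^sub>R v)) + norm (E (z *\<^sub>R v))))"
      unfolding abs_mult using t
      by (intro mult_mono order_trans[OF Cauchy_Schwarz_ineq2] mult_left_mono norm_triangle_ineq4) auto
    also have "\<dots> \<le> t * (M * (c * (t * M) + c * (t * M)))"
      using t M E[OF s1(1)] E[OF s1(2)] by (intro mult_mono add_mono) (auto intro: add_nonneg_nonneg)
    also have "\<dots> = e * t\<^sup>2" using M by (simp add: c_def field_simps power2_eq_square)
    finally show ?thesis by (simp add: f_def algebra_simps)
  qed
  show ?thesis
    unfolding eventually_at_right_field using d est by blast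
qed

text \<open>Exchanging \<open>u\<close> and \<open>v\<close> leaves the second difference unchanged,
  so \<open>t\<^sup>2 * (H u \<bullet> v)\<close> and \<open>t\<^sup>2 * (H v \<bullet> u)\<close>
  approximate the same quantity up to an arbitrarily small multiple of
  \<open>t\<^sup>2\<close>.\<close>

lemma hessian_symmetric:
  fixes \<rho> :: "'a::euclidean_space \<Rightarrow> real"
  assumes "open U" "p \<in> U" "\<And>x. x \<in> U \<Longrightarrow> GDERIV \<rho> x :> g x" "(g has_derivative H) (at p)"
  shows "H u \<bullet> v = u \<bullet> H v"
proof -
  have "\<bar>H u \<bullet> v - H v \<bullet> u\<bar> \<le> e" if "e > 0" for e
  proof -
    have e2: "e / 2 > 0" using that by simp
    have est: "\<forall>\<^sub>F t in at_right 0. \<bar>\<rho> (p + t *\<^sub>R u + t *\<^sub>R v) - \<rho> (p + t *\<^sub>R u) - \<rho> (p + t *\<^sub>R v) + \<rho> p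
        - t\<^sup>2 * (H u \<bullet> v)\<bar> \<le> e / 2 * t\<^sup>2" for u v
      using assms e2 by (intro second_difference_estimate) auto
    have "\<forall>\<^sub>F t::real in at_right 0. t > 0"
      by (simp add: eventually_at_right_less)
    then have "\<forall>\<^sub>F t::real in at_right 0. \<bar>H u \<bullet> v - H v \<bullet> u\<bar> \<le> e"
      using est[of u v] est[of v u]
    proof eventually_elim
      case (elim t)
      have swap: "p + t *\<^sub>R v + t *\<^sub>R u = p + t *\<^sub>R u + t *\<^sub>R v" by simp
      have "\<bar>t\<^sup>2 * (H u \<bullet> v) - t\<^sup>2 * (H v \<bullet> u)\<bar> \<le> e / 2 * t\<^sup>2 + e / 2 * t\<^sup>2"
        using elim(2,3) unfolding swap by linarith
      also have "\<dots> = t\<^sup>2 * e" by simp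
      finally have "\<bar>t\<^sup>2 * (H u \<bullet> v) - t\<^sup>2 * (H v \<bullet> u)\<bar> \<le> t\<^sup>2 * e" .
      then have "t\<^sup>2 * \<bar>H u \<bullet> v - H v \<bullet> u\<bar> \<le> t\<^sup>2 * e"
        by (simp add: abs_mult flip: right_diff_distrib)
      then show ?case using elim(1) by simp
    qed
    then show ?thesis by (simp add: eventually_const_iff trivial_limit_at_right_real)
  qed
  then have "\<bar>H u \<bullet> v - H v \<bullet> u\<bar> \<le> 0" by (rule field_le_epsilon[of _ 0, simplified])
  then show ?thesis by (simp add: inner_commute)
qed

section \<open>First-order behaviour along rays and on level sets\<close>

lemma GDERIV_line:
  assumes "GDERIV \<rho> w :> g"
  shows "((\<lambda>t. \<rho> (w + t *\<^sub>R v)) has_real_derivative g \<bullet> v) (at 0)"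
proof -
  have "(\<rho> has_derivative (\<lambda>h. h \<bullet> g)) (at (w + 0 *\<^sub>R v))"
    using assms by (simp add: gderiv_def)
  moreover have "((\<lambda>s. w + s *\<^sub>R v) has_derivative (\<lambda>h. h *\<^sub>R v)) (at 0)"
    by (auto intro!: derivative_eq_intros)
  ultimately have "((\<lambda>s. \<rho> (w + s *\<^sub>R v)) has_derivative (\<lambda>h. (h *\<^sub>R v) \<bullet> g)) (at 0)"
    using has_derivative_compose by fastforce
  then show ?thesis
    by (simp add: has_field_derivative_def mult.commute[of _ "g \<bullet> _"] inner_commute)
qed

lemma eventually_pos_along:
  assumes "GDERIV \<rho> w :> g" "\<rho> w = 0" "g \<bullet> v > 0"
  shows "\<forall>\<^sub>F t in at_right 0. \<rho> (w + t *\<^sub>R v) > 0"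
  using has_real_derivative_pos_inc_right[OF has_field_derivative_at_within[OF GDERIV_line[OF assms(1), of v]] assms(3), of UNIV] assms(2)
  by (auto simp: eventually_at_right_field)

lemma eventually_neg_along:
  assumes "GDERIV \<rho> w :> g" "\<rho> w = 0" "g \<bullet> v < 0"
  shows "\<forall>\<^sub>F t in at_right 0. \<rho> (w + t *\<^sub>R v) < 0"
  using eventually_pos_along[OF GDERIV_minus[OF assms(1)], of v] assms(2,3) by simp

lemma eventually_mem_along:
  fixes w :: "'a::real_normed_vector"
  assumes "open U" "w \<in> U"
  shows "\<forall>\<^sub>F t in at_right 0. w + t *\<^sub>R v \<in> U"
proof -
  have "((\<lambda>t. w + t *\<^sub>R v) \<longlongrightarrow> w + 0 *\<^sub>R v) (at_right 0)"
    by (intro tendsto_intros)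
  then show ?thesis using assms topological_tendstoD by fastforce
qed

text \<open>The hypothesis says that \<open>X\<close> lies in the contingent cone of \<open>S\<close> at \<open>w\<close>.\<close>

lemma has_derivative_within_unique_contingent:
  assumes D1: "(f has_derivative D1) (at w within S)" and D2: "(f has_derivative D2) (at w within S)"
    and cone: "\<And>e. e > 0 \<Longrightarrow> \<exists>t Z. 0 < t \<and> t < e \<and> norm (Z - X) < e \<and> w + t *\<^sub>R Z \<in> S"
  shows "D1 X = D2 X"
proof -
  define D where "D h = D1 h - D2 h" for h
  have bl: "bounded_linear D" unfolding D_def
    by (intro bounded_linear_sub has_derivative_bounded_linear[OF D1] has_derivative_bounded_linear[OF D2])
  then interpret D: bounded_linear D .
  obtain K where K: "K > 0" "\<And>x. norm (D x) \<le> norm x * K" using D.pos_bounded by blast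
  \<comment> \<open>In \<open>D X = D Z - D (Z - X)\<close> the first term is at most
    \<open>2 * e * (norm X + 1)\<close>, because \<open>D1\<close> and \<open>D2\<close> approximate
    the same increment of \<open>f\<close>, and the second is at most \<open>e * K\<close>.\<close>
  define C where "C = 2 * (norm X + 1) + K"
  have C: "C > 0" using K by (auto simp: C_def intro!: add_nonneg_pos)
  have main: "norm (D X) \<le> e * C" if e: "0 < e" "e \<le> 1" for e
  proof -
    obtain d1 where d1: "d1 > 0" "\<And>y. y \<in> S \<Longrightarrow> norm (y - w) < d1 \<Longrightarrow> norm (f y - f w - D1 (y - w)) \<le> e * norm (y - w)"
      using D1 e unfolding has_derivative_within_alt by blast
    obtain d2 where d2: "d2 > 0" "\<And>y. y \<in> S \<Longrightarrow> norm (y - w) < d2 \<Longrightarrow> norm (f y - f w - D2 (y - w)) \<le> e * norm (y - w)"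
      using D2 e unfolding has_derivative_within_alt by blast
    have "norm X + 1 > 0" by (auto intro: add_nonneg_pos)
    \<comment> \<open>From \<open>r \<le> e \<le> 1\<close> comes
      \<open>norm Z \<le> norm X + 1\<close>; the other bound then keeps
      \<open>t *\<^sub>R Z\<close> shorter than \<open>d1\<close> and \<open>d2\<close>.\<close>
    define r where "r = min e (min d1 d2 / (norm X + 1))"
    have "r > 0" using e d1 d2 \<open>norm X + 1 > 0\<close> by (simp add: r_def)
    then obtain t Z where tZ: "0 < t" "t < r" "norm (Z - X) < r" "w + t *\<^sub>R Z \<in> S" using cone by blast
    have nZ: "norm Z \<le> norm X + 1"
      using norm_triangle_ineq[of "Z - X" X] tZ e by (simp add: r_def)
    have "t * norm Z \<le> t * (norm X + 1)" using nZ tZ by simp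
    also have "\<dots> < min d1 d2"
      using tZ \<open>norm X + 1 > 0\<close> by (simp add: r_def pos_less_divide_eq)
    finally have sm: "norm (w + t *\<^sub>R Z - w) < d1" "norm (w + t *\<^sub>R Z - w) < d2" using tZ by auto
    have "norm (D (t *\<^sub>R Z)) \<le> e * norm (t *\<^sub>R Z) + e * norm (t *\<^sub>R Z)"
      using d1(2)[OF tZ(4) sm(1)] d2(2)[OF tZ(4) sm(2)]
        norm_triangle_ineq4[of "f (w + t *\<^sub>R Z) - f w - D2 (t *\<^sub>R Z)" "f (w + t *\<^sub>R Z) - f w - D1 (t *\<^sub>R Z)"]
      by (simp add: D_def)
    then have "t * norm (D Z) \<le> t * (2 * e * norm Z)" using tZ by (simp add: D.scaleR)
    then have "norm (D Z) \<le> 2 * e * norm Z" using tZ by simp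
    also have "\<dots> \<le> 2 * e * (norm X + 1)" using nZ e by simp
    finally have 1: "norm (D Z) \<le> 2 * e * (norm X + 1)" .
    have "norm (D (Z - X)) \<le> norm (Z - X) * K" by (rule K)
    also have "\<dots> \<le> e * K" using tZ K by (intro mult_right_mono) (auto simp: r_def)
    finally have "norm (D X) \<le> 2 * e * (norm X + 1) + e * K"
      using 1 norm_triangle_ineq4[of "D Z" "D (Z - X)"] by (simp add: D.diff)
    then show ?thesis by (simp add: C_def algebra_simps)
  qed
  have "norm (D X) \<le> 0 + e" if "e > 0" for e
  proof -
    have "norm (D X) \<le> min 1 (e / C) * C" using that C by (intro main) auto
    also have "\<dots> \<le> e / C * C" using C by (intro mult_right_mono) auto
    finally show ?thesis using C by simp
  qed
  then have "norm (D X) \<le> 0" by (rule field_le_epsilon)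
  then show ?thesis by (simp add: D_def)
qed

text \<open>Tilting \<open>X\<close> by a small multiple of \<open>g\<close> to either side makes
  \<open>\<rho>\<close> positive on one ray and negative on the other. For small \<open>t\<close>
  the intermediate value theorem finds a zero between the two rays, in a direction close to
  \<open>X\<close>.\<close>

lemma level_set_contingent:
  fixes \<rho> :: "'a::euclidean_space \<Rightarrow> real"
  assumes U: "open U" "w \<in> U" and cont: "continuous_on U \<rho>" and "GDERIV \<rho> w :> g" "g \<noteq> 0" "\<rho> w = 0"
    and "X \<bullet> g = 0" "e > 0"
  shows "\<exists>t Z. 0 < t \<and> t < e \<and> norm (Z - X) < e \<and> w + t *\<^sub>R Z \<in> {z \<in> U. \<rho> z = 0}"
proof -
  define \<sigma> where "\<sigma> = e / (2 * norm g)"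
  have \<sigma>: "\<sigma> > 0" "\<sigma> * norm g < e" using assms by (auto simp: \<sigma>_def)
  obtain r where r: "r > 0" "ball w r \<subseteq> U" using U open_contains_ball by blast
  have gg: "g \<bullet> g > 0" using assms by simp
  have "\<forall>\<^sub>F t in at_right 0. \<rho> (w + t *\<^sub>R (X + \<sigma> *\<^sub>R g)) > 0"
    using \<sigma> gg assms by (intro eventually_pos_along) (auto simp: inner_add_right inner_commute)
  moreover have "\<forall>\<^sub>F t in at_right 0. \<rho> (w + t *\<^sub>R (X + (-\<sigma>) *\<^sub>R g)) < 0"
    using \<sigma> gg assms by (intro eventually_neg_along) (auto simp: inner_diff_right inner_commute)
  moreover have "\<forall>\<^sub>F t in at_right 0. w + t *\<^sub>R (X + \<sigma> *\<^sub>R g) \<in> ball w r"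
    using r by (intro eventually_mem_along) auto
  moreover have "\<forall>\<^sub>F t in at_right 0. w + t *\<^sub>R (X + (-\<sigma>) *\<^sub>R g) \<in> ball w r"
    using r by (intro eventually_mem_along) auto
  moreover have "\<forall>\<^sub>F t in at_right 0. 0 < t \<and> t < e"
    using \<open>e > 0\<close> by (auto simp: eventually_at_right_field)
  ultimately have "\<forall>\<^sub>F t in at_right 0. 0 < t \<and> t < e \<and> \<rho> (w + t *\<^sub>R (X + \<sigma> *\<^sub>R g)) > 0 \<and>
      \<rho> (w + t *\<^sub>R (X + (-\<sigma>) *\<^sub>R g)) < 0 \<and> w + t *\<^sub>R (X + \<sigma> *\<^sub>R g) \<in> ball w r \<and> w + t *\<^sub>R (X + (-\<sigma>) *\<^sub>R g) \<in> ball w r"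
    by eventually_elim auto
  then obtain t where t: "0 < t" "t < e" "\<rho> (w + t *\<^sub>R (X + \<sigma> *\<^sub>R g)) > 0"
      "\<rho> (w + t *\<^sub>R (X + (-\<sigma>) *\<^sub>R g)) < 0" "w + t *\<^sub>R (X + \<sigma> *\<^sub>R g) \<in> ball w r" "w + t *\<^sub>R (X + (-\<sigma>) *\<^sub>R g) \<in> ball w r"
    using eventually_happens'[OF trivial_limit_at_right_real] by blast
  \<comment> \<open>Convexity of the ball keeps the whole segment between the two rays inside
    \<open>U\<close>, where \<open>\<rho>\<close> is continuous.\<close>
  have seg: "w + t *\<^sub>R (X + s *\<^sub>R g) \<in> ball w r" if "s \<in> {-\<sigma>..\<sigma>}" for s
  proof -
    define a where "a = (s + \<sigma>) / (2 * \<sigma>)"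
    have a: "0 \<le> a" "a \<le> 1" "s = (1 - a) * (-\<sigma>) + a * \<sigma>" using that \<sigma> by (auto simp: a_def field_simps)
    have "(1 - a) *\<^sub>R (w + t *\<^sub>R (X + (-\<sigma>) *\<^sub>R g)) + a *\<^sub>R (w + t *\<^sub>R (X + \<sigma> *\<^sub>R g)) \<in> ball w r"
      using a t by (intro convexD_alt[OF convex_ball]) auto
    also have "(1 - a) *\<^sub>R (w + t *\<^sub>R (X + (-\<sigma>) *\<^sub>R g)) + a *\<^sub>R (w + t *\<^sub>R (X + \<sigma> *\<^sub>R g)) = w + t *\<^sub>R (X + s *\<^sub>R g)"
      unfolding a(3) by (simp add: algebra_simps) (simp add: scaleR_2[symmetric] mult_ac)
    finally show ?thesis .
  qed
  have "\<exists>s\<ge>-\<sigma>. s \<le> \<sigma> \<and> \<rho> (w + t *\<^sub>R (X + s *\<^sub>R g)) = 0"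
  proof (rule IVT')
    show "continuous_on {-\<sigma>..\<sigma>} (\<lambda>s. \<rho> (w + t *\<^sub>R (X + s *\<^sub>R g)))"
      using seg r by (intro continuous_on_compose2[OF cont] continuous_intros) blast
  qed (use t \<sigma> in auto)
  then obtain s where s: "-\<sigma> \<le> s" "s \<le> \<sigma>" "\<rho> (w + t *\<^sub>R (X + s *\<^sub>R g)) = 0" by blast
  have "\<bar>s\<bar> * norm g \<le> \<sigma> * norm g" using s by (intro mult_right_mono) auto
  then have "norm (X + s *\<^sub>R g - X) < e" using \<sigma> by simp
  moreover have "w + t *\<^sub>R (X + s *\<^sub>R g) \<in> U" using seg[of s] s r by auto
  ultimately show ?thesis using s t by blast
qed

section \<open>The second fundamental form of a boundary\<close>

lemma local_defining_function_at:
  "local_defining_function \<Omega> p U \<rho> \<Longrightarrow> q \<in> U \<Longrightarrow> local_defining_function \<Omega> q U \<rho>"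
  by (simp add: local_defining_function_def)

lemma GDERIV_unique: "GDERIV f x :> a \<Longrightarrow> GDERIV f x :> b \<Longrightarrow> a = b" for a b :: "'a::euclidean_space"
  unfolding gderiv_def by (drule (1) has_derivative_unique) (metis inner_commute vector_eq_rdot)

text \<open>A ray with \<open>g1 \<bullet> v < 0\<close> enters \<open>\<Omega>\<close>, where
  \<open>\<rho>2\<close> is negative too, so \<open>g2 \<bullet> v \<le> 0\<close>. An open
  half-space contained in a closed one, both bounded by hyperplanes through 0, determines the unit
  normal.\<close>

lemma defining_gradients_proportional:
  fixes \<Omega> :: "'a::euclidean_space set"
  assumes p: "p \<in> frontier \<Omega>"
    and 1: "local_defining_function \<Omega> p U1 \<rho>1" "GDERIV \<rho>1 p :> g1"
    and 2: "local_defining_function \<Omega> p U2 \<rho>2" "GDERIV \<rho>2 p :> g2"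
  shows "g1 /\<^sub>R norm g1 = g2 /\<^sub>R norm g2"
proof -
  have open_U: "open U1" "p \<in> U1" "open U2" "p \<in> U2"
    and dom: "\<Omega> \<inter> U1 = {z \<in> U1. \<rho>1 z < 0}" "\<Omega> \<inter> U2 = {z \<in> U2. \<rho>2 z < 0}"
    and zero: "\<rho>1 p = 0" "\<rho>2 p = 0"
    and nz: "g1 \<noteq> 0" "g2 \<noteq> 0"
    using assms by (auto simp: local_defining_function_def)
  have strict: "g2 \<bullet> v \<le> 0" if "g1 \<bullet> v < 0" for v
  proof (rule ccontr)
    assume "\<not> g2 \<bullet> v \<le> 0"
    then have "\<forall>\<^sub>F t in at_right 0. \<rho>2 (p + t *\<^sub>R v) > 0"
      using 2(2) zero by (intro eventually_pos_along) auto
    moreover have "\<forall>\<^sub>F t in at_right 0. \<rho>1 (p + t *\<^sub>R v) < 0"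
      using 1(2) zero that by (intro eventually_neg_along) auto
    moreover note eventually_mem_along[OF open_U(1,2), of v] eventually_mem_along[OF open_U(3,4), of v]
    ultimately have "\<forall>\<^sub>F t::real in at_right 0. False"
    proof eventually_elim
      case (elim t)
      then have "p + t *\<^sub>R v \<in> \<Omega> \<inter> U1" unfolding dom by blast
      with elim have "p + t *\<^sub>R v \<in> \<Omega> \<inter> U2" by blast
      with elim(1) show False unfolding dom by simp
    qed
    then show False by (simp add: trivial_limit_at_right_real)
  qed
  define a b where "a = g1 /\<^sub>R norm g1" and "b = g2 /\<^sub>R norm g2"
  have ab: "norm a = 1" "norm b = 1" "a \<bullet> a = 1" "b \<bullet> b = 1"
    using nz by (auto simp: a_def b_def power2_norm_eq_inner[symmetric] simp flip: inner_scaleR_left)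
  have strict': "b \<bullet> v \<le> 0" if "a \<bullet> v < 0" for v
    using strict[of v] that nz by (auto simp: a_def b_def divide_less_0_iff mult_less_0_iff mult_le_0_iff field_simps)
  \<comment> \<open>The test vector \<open>b - a\<close> satisfies only
    \<open>a \<bullet> (b - a) \<le> 0\<close>; subtracting \<open>e *\<^sub>R a\<close> makes this
    strict. In the limit \<open>a \<bullet> b \<ge> 1\<close>, which forces equality of the unit
    vectors.\<close>
  have "b \<bullet> (b - a) \<le> e" if "e > 0" for e
  proof -
    have le: "a \<bullet> b \<le> 1" using norm_cauchy_schwarz[of a b] ab by simp
    have "b \<bullet> (b - a - e *\<^sub>R a) \<le> 0"
      using ab le that by (intro strict') (simp add: inner_diff_right)
    moreover have "e * (b \<bullet> a) \<le> e * 1" using le that by (intro mult_left_mono) (auto simp: inner_commute)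
    ultimately show ?thesis by (simp add: inner_diff_right)
  qed
  then have "b \<bullet> (b - a) \<le> 0" by (rule field_le_epsilon[of _ 0, simplified])
  then have "(a - b) \<bullet> (a - b) \<le> 0" using ab by (simp add: inner_diff_right inner_diff_left inner_commute)
  then have "a = b" by (metis inner_ge_zero inner_eq_zero_iff antisym eq_iff_diff_eq_0)
  then show ?thesis by (simp add: a_def b_def)
qed

lemma inward_unit_normal_eq:
  assumes "p \<in> frontier \<Omega>" "local_defining_function \<Omega> p U \<rho>" "GDERIV \<rho> p :> g"
  shows "inward_unit_normal \<Omega> p = - (g /\<^sub>R norm g)"
  unfolding inward_unit_normal_def
proof (rule the_equality)
  fix v assume "\<exists>U \<rho> g. local_defining_function \<Omega> p U \<rho> \<and> GDERIV \<rho> p :> g \<and> v = - (g /\<^sub>R norm g)"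
  then obtain U' \<rho>' g' where "local_defining_function \<Omega> p U' \<rho>'" "GDERIV \<rho>' p :> g'" "v = - (g' /\<^sub>R norm g')"
    by blast
  then show "v = - (g /\<^sub>R norm g)" using defining_gradients_proportional[OF assms(1)] assms(2,3) by metis
qed (use assms in blast)

lemma boundary_tangent_space_eq:
  assumes "w \<in> frontier \<Omega>" "local_defining_function \<Omega> w U \<rho>" "GDERIV \<rho> w :> g"
  shows "boundary_tangent_space \<Omega> w = {X. X \<bullet> g = 0}"
proof -
  have "g \<noteq> 0" using assms by (auto simp: local_defining_function_def)
  then show ?thesis by (simp add: boundary_tangent_space_def inward_unit_normal_eq[OF assms])
qed

text \<open>Near \<open>w\<close> the normal field is the restriction of
  \<open>- g / norm g\<close>, which is differentiable in the ambient space. Differentiating the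
  factor \<open>1 / norm g\<close> yields only a multiple of \<open>g w\<close>, orthogonal to
  \<open>Y\<close>.\<close>

lemma second_fundamental_form_eq:
  assumes w: "w \<in> frontier \<Omega>" and ldf: "local_defining_function \<Omega> w U \<rho>"
    and g: "\<And>x. x \<in> U \<Longrightarrow> GDERIV \<rho> x :> g x" and H: "(g has_derivative H) (at w)"
    and tangent: "X \<bullet> g w = 0" "Y \<bullet> g w = 0"
  shows "second_fundamental_form \<Omega> w X Y = H X \<bullet> Y / norm (g w)"
proof -
  have U: "open U" "w \<in> U" "frontier \<Omega> \<inter> U = {z \<in> U. \<rho> z = 0}"
    using ldf by (auto simp: local_defining_function_def)
  have nz: "g w \<noteq> 0" using ldf g[OF U(2)] w by (auto simp: local_defining_function_def)
  have normal: "inward_unit_normal \<Omega> x = - (g x /\<^sub>R norm (g x))" if "x \<in> frontier \<Omega> \<inter> U" for x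
    using that inward_unit_normal_eq[OF _ local_defining_function_at[OF ldf] g] by blast
  define D where "D X = - ((inverse (norm (g w))) *\<^sub>R H X - ((H X \<bullet> g w) / norm (g w) ^ 3) *\<^sub>R g w)" for X
  have norm_deriv: "((\<lambda>x. norm (g x)) has_derivative (\<lambda>h. H h \<bullet> sgn (g w))) (at w)"
    using has_derivative_compose[OF H has_derivative_norm[OF nz]] .
  have "((\<lambda>x. - (g x /\<^sub>R norm (g x))) has_derivative D) (at w)"
    unfolding D_def using nz
    by (auto intro!: derivative_eq_intros H norm_deriv
        simp: fun_eq_iff sgn_div_norm divide_simps power3_eq_cube inner_commute)
  then have N: "((\<lambda>x. - (g x /\<^sub>R norm (g x))) has_derivative D) (at w within frontier \<Omega>)"
    by (rule has_derivative_at_withinI)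
  obtain r where r: "r > 0" "ball w r \<subseteq> U" using U open_contains_ball by blast
  have D: "(inward_unit_normal \<Omega> has_derivative D) (at w within frontier \<Omega>)"
    by (rule has_derivative_transform_within[OF N r(1) w])
       (use r(2) normal in \<open>auto simp: subset_eq dist_commute\<close>)
  \<comment> \<open>\<open>frechet_derivative\<close> selects some derivative within the boundary,
    possibly different from \<open>D\<close> in the normal direction. The two are compared only at
    the tangent vector \<open>X\<close>, a limit of directions into the boundary.\<close>
  then have D': "(inward_unit_normal \<Omega> has_derivative frechet_derivative (inward_unit_normal \<Omega>) (at w within frontier \<Omega>))
      (at w within frontier \<Omega>)"
    using frechet_derivative_works differentiable_def by blast
  have cont: "continuous_on U \<rho>"
    using g by (auto simp: gderiv_def intro!: continuous_at_imp_continuous_on has_derivative_continuous)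
  have zero: "\<rho> w = 0" using U w by blast
  have "frechet_derivative (inward_unit_normal \<Omega>) (at w within frontier \<Omega>) X = D X"
  proof (rule has_derivative_within_unique_contingent[OF D' D])
    show "\<exists>t Z. 0 < t \<and> t < e \<and> norm (Z - X) < e \<and> w + t *\<^sub>R Z \<in> frontier \<Omega>" if "e > 0" for e
      using level_set_contingent[OF U(1,2) cont g[OF U(2)] nz zero tangent(1) that] U(3) by blast
  qed
  then show ?thesis
    using tangent nz by (simp add: second_fundamental_form_def D_def inner_diff_left inner_commute[of "g w"] divide_inverse mult.commute)
qed

section \<open>Orthonormal bases\<close>

lemma orthonormal_imp_independent:
  assumes "pairwise orthogonal B" "\<And>x. x \<in> B \<Longrightarrow> norm x = 1"
  shows "independent B"
  using assms by (intro pairwise_orthogonal_independent) force+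

lemma orthonormal_spanning:
  fixes B :: "'a::euclidean_space set"
  assumes "pairwise orthogonal B" "\<And>x. x \<in> B \<Longrightarrow> norm x = 1" "card B = DIM('a)"
  shows "span B = UNIV"
proof -
  have "independent B" using orthonormal_imp_independent assms by blast
  then show ?thesis
    using assms(3) card_eq_dim[of B UNIV] independent_imp_finite[of B] by auto
qed

lemma parseval:
  fixes B :: "'a::euclidean_space set"
  assumes B: "pairwise orthogonal B" "\<And>x. x \<in> B \<Longrightarrow> norm x = 1" "span B = UNIV"
  shows "(\<Sum>b\<in>B. (x \<bullet> b) * (y \<bullet> b)) = x \<bullet> y"
proof -
  have fin: "finite B" using B(1) by (rule pairwise_orthogonal_imp_finite)
  have "(\<Sum>b\<in>B. (y \<bullet> b) *\<^sub>R b) = y"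
    using B fin by (intro orthonormal_basis_expand) auto
  then have "x \<bullet> y = x \<bullet> (\<Sum>b\<in>B. (y \<bullet> b) *\<^sub>R b)" by simp
  then show ?thesis by (simp add: inner_sum_right mult.commute)
qed

lemma orthonormal_extension:
  fixes S :: "'a::euclidean_space set"
  assumes "pairwise orthogonal S" "\<And>x. x \<in> S \<Longrightarrow> norm x = 1"
  shows "\<exists>B. S \<subseteq> B \<and> pairwise orthogonal B \<and> (\<forall>x\<in>B. norm x = 1) \<and> span B = UNIV"
proof -
  obtain U where U: "U \<inter> insert 0 S = {}" "pairwise orthogonal (S \<union> U)" "span (S \<union> U) = span (S \<union> UNIV)"
    using orthogonal_extension_strong[OF assms(1), of UNIV] by blast
  have nz: "x \<noteq> 0" if "x \<in> S \<union> U" for x using that U(1) assms(2) by force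
  show ?thesis
  proof (intro exI conjI ballI)
    show "S \<subseteq> (\<lambda>x. x /\<^sub>R norm x) ` (S \<union> U)"
    proof
      fix x assume "x \<in> S"
      then show "x \<in> (\<lambda>x. x /\<^sub>R norm x) ` (S \<union> U)" using assms(2)[of x] by (intro image_eqI[of _ _ x]) auto
    qed
    show "pairwise orthogonal ((\<lambda>x. x /\<^sub>R norm x) ` (S \<union> U))"
      unfolding pairwise_image
    proof (intro pairwiseI impI)
      fix x y assume "x \<in> S \<union> U" "y \<in> S \<union> U" "x \<noteq> y"
      then have "orthogonal x y" using U(2) by (simp add: pairwise_def)
      then show "orthogonal (x /\<^sub>R norm x) (y /\<^sub>R norm y)" by (simp add: orthogonal_def)
    qed
    show "norm x = 1" if "x \<in> (\<lambda>x. x /\<^sub>R norm x) ` (S \<union> U)" for x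
      using that nz by auto
    have "span ((\<lambda>x. (inverse (norm x)) *\<^sub>R x) ` (S \<union> U)) = span (S \<union> U)"
      using nz U(2) by (intro span_image_scale pairwise_orthogonal_imp_finite) auto
    then show "span ((\<lambda>x. x /\<^sub>R norm x) ` (S \<union> U)) = UNIV" using U(3) by simp
  qed
qed

text \<open>
  No spectral theorem is needed: the hypothesis forces the dimensions of the eigenspaces to add up
  to the dimension of the hyperplane, and self-adjointness makes distinct eigenspaces orthogonal.
\<close>

lemma orthonormal_eigenbasis:
  fixes f :: "'a::euclidean_space \<Rightarrow> 'a"
  assumes "linear f" and sym: "\<And>X Y. f X \<bullet> Y = X \<bullet> f Y"
    and mult: "\<And>c. card {i \<in> I. \<kappa> i = c} = dim {X. X \<bullet> n = 0 \<and> (\<forall>Y. Y \<bullet> n = 0 \<longrightarrow> f X \<bullet> Y = c * (X \<bullet> Y))}"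
    and "finite I"
  obtains e where "\<And>i. i \<in> I \<Longrightarrow> e i \<bullet> n = 0"
    and "\<And>i j. i \<in> I \<Longrightarrow> j \<in> I \<Longrightarrow> e i \<bullet> e j = (if i = j then 1 else 0)"
    and "\<And>i Y. i \<in> I \<Longrightarrow> Y \<bullet> n = 0 \<Longrightarrow> f (e i) \<bullet> Y = \<kappa> i * (e i \<bullet> Y)"
proof -
  interpret f: linear f by fact
  define E where "E c = {X. X \<bullet> n = 0 \<and> (\<forall>Y. Y \<bullet> n = 0 \<longrightarrow> f X \<bullet> Y = c * (X \<bullet> Y))}" for c
  \<comment> \<open>For each \<open>c\<close>, an orthonormal basis of the eigenspace is indexed by
    the \<open>i\<close> with \<open>\<kappa> i = c\<close>; the multiplicity hypothesis says that
    these are equally many.\<close>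
  have "\<exists>b. b ` {i \<in> I. \<kappa> i = c} \<subseteq> E c \<and> inj_on b {i \<in> I. \<kappa> i = c} \<and>
      pairwise orthogonal (b ` {i \<in> I. \<kappa> i = c}) \<and> (\<forall>i\<in>{i \<in> I. \<kappa> i = c}. norm (b i) = 1)" for c
  proof -
    have "subspace (E c)"
      by (auto simp: E_def subspace_def f.zero f.add f.scaleR inner_add_left distrib_left mult.left_commute)
    then obtain B where B: "B \<subseteq> E c" "pairwise orthogonal B" "\<And>x. x \<in> B \<Longrightarrow> norm x = 1" "card B = dim (E c)"
      by (rule orthonormal_basis_subspace) blast
    have "finite B" using B(2) by (rule pairwise_orthogonal_imp_finite)
    then obtain b where "bij_betw b {i \<in> I. \<kappa> i = c} B"
      using finite_same_card_bij[of "{i \<in> I. \<kappa> i = c}" B] mult[of c] B(4) \<open>finite I\<close> by (auto simp: E_def)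
    with B show ?thesis by (auto simp: bij_betw_def intro!: exI[of _ b])
  qed
  then have "\<exists>b. \<forall>c. b c ` {i \<in> I. \<kappa> i = c} \<subseteq> E c \<and> inj_on (b c) {i \<in> I. \<kappa> i = c} \<and>
      pairwise orthogonal (b c ` {i \<in> I. \<kappa> i = c}) \<and> (\<forall>i\<in>{i \<in> I. \<kappa> i = c}. norm (b c i) = 1)"
    by (intro choice allI)
  then obtain b where b: "\<And>c. b c ` {i \<in> I. \<kappa> i = c} \<subseteq> E c \<and> inj_on (b c) {i \<in> I. \<kappa> i = c} \<and>
      pairwise orthogonal (b c ` {i \<in> I. \<kappa> i = c}) \<and> (\<forall>i\<in>{i \<in> I. \<kappa> i = c}. norm (b c i) = 1)"
    by blast
  define e where "e i = b (\<kappa> i) i" for i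
  have inE: "e i \<in> E (\<kappa> i)" if "i \<in> I" for i using b[of "\<kappa> i"] that by (auto simp: e_def)
  show thesis
  proof
    show tang: "e i \<bullet> n = 0" if "i \<in> I" for i using inE[OF that] by (simp add: E_def)
    show eig: "f (e i) \<bullet> Y = \<kappa> i * (e i \<bullet> Y)" if "i \<in> I" "Y \<bullet> n = 0" for i Y
      using inE[OF that(1)] that(2) by (simp add: E_def)
    show "e i \<bullet> e j = (if i = j then 1 else 0)" if ij: "i \<in> I" "j \<in> I" for i j
    proof (cases "\<kappa> i = \<kappa> j")
      case True
      have "norm (e i) = 1" using b[of "\<kappa> i"] ij by (simp add: e_def)
      moreover have "orthogonal (e i) (e j)" if "i \<noteq> j"
      proof -
        have "b (\<kappa> i) i \<noteq> b (\<kappa> i) j" using b[of "\<kappa> i"] ij that True by (auto simp: inj_on_def)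
        then show ?thesis using b[of "\<kappa> i"] ij that True by (auto simp: pairwise_def e_def)
      qed
      ultimately show ?thesis by (auto simp: orthogonal_def norm_eq_1)
    next
      case False
      have "\<kappa> i * (e i \<bullet> e j) = f (e i) \<bullet> e j" using eig tang ij by simp
      also have "\<dots> = f (e j) \<bullet> e i" by (simp only: sym[of "e i" "e j"] inner_commute[of "e i"])
      also have "\<dots> = \<kappa> j * (e i \<bullet> e j)" using eig tang ij by (simp add: inner_commute)
      finally show ?thesis using False by auto
    qed
  qed
qed

lemma orthonormal_family:
  fixes e :: "nat \<Rightarrow> 'a::euclidean_space"
  assumes "\<And>i j. i \<in> I \<Longrightarrow> j \<in> I \<Longrightarrow> e i \<bullet> e j = (if i = j then 1 else 0)"
  shows "inj_on e I" "independent (e ` I)"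
proof -
  show inj: "inj_on e I"
  proof (rule inj_onI)
    fix i j assume "i \<in> I" "j \<in> I" "e i = e j"
    then show "i = j" using assms[of i j] assms[of i i] by (auto split: if_splits)
  qed
  show "independent (e ` I)"
    using assms by (intro orthonormal_imp_independent) (auto simp: pairwise_image norm_eq_1 orthogonal_def intro!: pairwiseI)
qed

text \<open>Adjoining the unit normal to the family gives an orthonormal basis of the whole space,
  and the coefficient of \<open>X\<close> along the normal vanishes.\<close>

lemma orthonormal_hyperplane_expand:
  fixes e :: "nat \<Rightarrow> 'a::euclidean_space"
  assumes n: "n \<noteq> 0" and tang: "\<And>i. i \<in> I \<Longrightarrow> e i \<bullet> n = 0"
    and orth: "\<And>i j. i \<in> I \<Longrightarrow> j \<in> I \<Longrightarrow> e i \<bullet> e j = (if i = j then 1 else 0)"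
    and "card I = DIM('a) - 1" "finite I" and X: "X \<bullet> n = 0"
  shows "(\<Sum>i\<in>I. (X \<bullet> e i) *\<^sub>R e i) = X"
proof -
  define n' where "n' = n /\<^sub>R norm n"
  define B where "B = insert n' (e ` I)"
  have nn: "norm n' = 1" using n by (simp add: n'_def)
  have ne: "e i \<bullet> n' = 0" if "i \<in> I" for i using tang[OF that] by (simp add: n'_def)
  have inj: "inj_on e I" using orth by (rule orthonormal_family)
  have nin: "n' \<notin> e ` I"
  proof
    assume "n' \<in> e ` I"
    then obtain i where "i \<in> I" "n' = e i" by blast
    then have "n' \<bullet> n' = 0" using ne[of i] by metis
    then show False using nn by simp
  qed
  have "orthogonal n' (e i) \<and> orthogonal (e i) n'" if "i \<in> I" for i
    using ne[OF that] by (simp add: orthogonal_def inner_commute)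
  moreover have "orthogonal (e i) (e j)" if "i \<in> I" "j \<in> I" "i \<noteq> j" for i j
    using orth that by (simp add: orthogonal_def)
  ultimately have orthB: "pairwise orthogonal B"
    by (auto simp: B_def pairwise_insert pairwise_image intro!: pairwiseI)
  have normB: "norm x = 1" if "x \<in> B" for x using that nn orth by (auto simp: B_def norm_eq_1)
  have "card B = DIM('a)"
    using assms(4) nin inj \<open>finite I\<close> DIM_positive[where 'a='a] by (simp add: B_def card_image)
  then have "span B = UNIV" using orthB normB by (intro orthonormal_spanning)
  then have "(\<Sum>b\<in>B. (X \<bullet> b) *\<^sub>R b) = X"
    using orthB normB \<open>finite I\<close> by (intro orthonormal_basis_expand) (auto simp: B_def)
  moreover have "X \<bullet> n' = 0" using X by (simp add: n'_def)
  ultimately show ?thesis using nin inj \<open>finite I\<close> by (simp add: B_def sum.reindex)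
qed

section \<open>The complex structure and the Levi form\<close>

lemma inner_i_i: "(\<i> *s X) \<bullet> (\<i> *s Y) = X \<bullet> (Y :: complex ^ 'n)"
  by (auto simp: inner_vec_def inner_complex_def intro!: sum.cong)

lemma inner_i_left: "(\<i> *s X) \<bullet> Y = - (X \<bullet> (\<i> *s (Y :: complex ^ 'n)))"
  by (auto simp: inner_vec_def inner_complex_def sum_negf[symmetric] intro!: sum.cong)

lemma inner_i_self: "(\<i> *s X) \<bullet> X = 0" for X :: "complex ^ 'n"
  by (auto simp: inner_vec_def inner_complex_def intro!: sum.neutral)

lemma i_i: "\<i> *s (\<i> *s X) = - (X :: complex ^ 'n)"
  by (simp add: vec_eq_iff flip: mult.assoc)

lemma linear_i: "linear ((*s) \<i> :: complex ^ 'n \<Rightarrow> complex ^ 'n)"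
  by (intro linearI) (auto simp: vec_eq_iff algebra_simps scaleR_conv_of_real)

lemma complex_vec_expand:
  "X = (\<Sum>j\<in>UNIV. Re (X $ j) *\<^sub>R axis j 1 + Im (X $ j) *\<^sub>R axis j \<i>)" for X :: "complex ^ 'n::finite"
  by (simp add: vec_eq_iff sum_component axis_def if_distrib[of "\<lambda>x. _ *\<^sub>R x"] sum.distrib complex_eq_iff cong: if_cong)

text \<open>Expansion in real coordinates, so that the identity in \<open>levi_form_eq\<close> can
  be checked for each pair \<open>j\<close>, \<open>k\<close> separately.\<close>

lemma bilinear_complex_vec_expand:
  fixes H :: "complex ^ 'n::finite \<Rightarrow> complex ^ 'n"
  assumes "linear H"
  shows "H X \<bullet> Y = (\<Sum>j\<in>UNIV. \<Sum>k\<in>UNIV.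
     Re (X $ j) * Re (Y $ k) * (H (axis j 1) \<bullet> axis k 1) + Re (X $ j) * Im (Y $ k) * (H (axis j 1) \<bullet> axis k \<i>) +
     Im (X $ j) * Re (Y $ k) * (H (axis j \<i>) \<bullet> axis k 1) + Im (X $ j) * Im (Y $ k) * (H (axis j \<i>) \<bullet> axis k \<i>))"
proof -
  interpret H: linear H by fact
  have "H X \<bullet> Y = H (\<Sum>j\<in>UNIV. Re (X $ j) *\<^sub>R axis j 1 + Im (X $ j) *\<^sub>R axis j \<i>) \<bullet>
      (\<Sum>k\<in>UNIV. Re (Y $ k) *\<^sub>R axis k 1 + Im (Y $ k) *\<^sub>R axis k \<i>)"
    using complex_vec_expand[of X] complex_vec_expand[of Y] by simp
  also have "\<dots> = (\<Sum>j\<in>UNIV. \<Sum>k\<in>UNIV. (Re (X $ j) *\<^sub>R H (axis j 1) + Im (X $ j) *\<^sub>R H (axis j \<i>)) \<bullet>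
      (Re (Y $ k) *\<^sub>R axis k 1 + Im (Y $ k) *\<^sub>R axis k \<i>))"
    by (simp only: H.sum H.add H.scaleR inner_sum_left inner_sum_right) (rule sum.swap)
  finally show ?thesis by (simp add: inner_add_left inner_add_right algebra_simps)
qed

section \<open>Wirtinger derivatives through gradient and Hessian\<close>

lemma directional_deriv_eqI:
  assumes "((\<lambda>t. f (p + t *\<^sub>R v)) has_vector_derivative d) (at 0)"
  shows "directional_deriv v f p = d"
  using assms by (simp add: directional_deriv_def vector_derivative_at)

lemma directional_deriv_of_real:
  assumes "GDERIV \<rho> p :> g"
  shows "directional_deriv v (\<lambda>z. of_real (\<rho> z)) p = of_real (g \<bullet> v)"
  using has_vector_derivative_of_real[OF GDERIV_line[OF assms, of v]]
  by (rule directional_deriv_eqI)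

lemma wirtinger_z_of_real:
  assumes "GDERIV \<rho> p :> g"
  shows "wirtinger_z j (\<lambda>z. of_real (\<rho> z)) p = Complex (g \<bullet> axis j 1) (- (g \<bullet> axis j \<i>)) / 2"
  by (simp add: wirtinger_z_def directional_deriv_of_real[OF assms] complex_eq_iff)

lemma wirtinger_zbar_of_real:
  assumes "GDERIV \<rho> p :> g"
  shows "wirtinger_zbar j (\<lambda>z. of_real (\<rho> z)) p = Complex (g \<bullet> axis j 1) (g \<bullet> axis j \<i>) / 2"
  by (simp add: wirtinger_zbar_def directional_deriv_of_real[OF assms] complex_eq_iff)

text \<open>The formula for the first Wirtinger derivative holds throughout the open set
  \<open>U\<close>, so it may be differentiated at \<open>p\<close>; it is linear in
  \<open>g\<close>, whose derivative is \<open>H\<close>.\<close>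

lemma directional_deriv_wirtinger_zbar:
  fixes \<rho> :: "complex ^ 'n::finite \<Rightarrow> real"
  assumes "open U" "p \<in> U" "\<And>x. x \<in> U \<Longrightarrow> GDERIV \<rho> x :> g x" and H: "(g has_derivative H) (at p)"
  shows "directional_deriv v (wirtinger_zbar k (\<lambda>z. of_real (\<rho> z))) p = Complex (H v \<bullet> axis k 1) (H v \<bullet> axis k \<i>) / 2"
proof -
  interpret H: bounded_linear H by (rule has_derivative_bounded_linear[OF H])
  have 1: "(wirtinger_zbar k (\<lambda>z. of_real (\<rho> z)) has_derivative
      (\<lambda>h. Complex (H h \<bullet> axis k 1) (H h \<bullet> axis k \<i>) / 2)) (at p)"
  proof (rule has_derivative_transform_within_open[OF _ assms(1,2)])
    show "((\<lambda>x. Complex (g x \<bullet> axis k 1) (g x \<bullet> axis k \<i>) / 2) has_derivative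
      (\<lambda>h. Complex (H h \<bullet> axis k 1) (H h \<bullet> axis k \<i>) / 2)) (at p)"
      unfolding Complex_eq by (auto intro!: derivative_eq_intros H)
  qed (use wirtinger_zbar_of_real assms(3) in metis)
  have 2: "((\<lambda>s. p + s *\<^sub>R v) has_derivative (\<lambda>h. h *\<^sub>R v)) (at 0)"
    by (auto intro!: derivative_eq_intros)
  have 3: "Complex (H (h *\<^sub>R v) \<bullet> axis k 1) (H (h *\<^sub>R v) \<bullet> axis k \<i>) / 2 =
      h *\<^sub>R (Complex (H v \<bullet> axis k 1) (H v \<bullet> axis k \<i>) / 2)" for h
    by (simp add: H.scaleR complex_eq_iff)
  have "((\<lambda>s. wirtinger_zbar k (\<lambda>z. of_real (\<rho> z)) (p + s *\<^sub>R v)) has_derivative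
      (\<lambda>h. h *\<^sub>R (Complex (H v \<bullet> axis k 1) (H v \<bullet> axis k \<i>) / 2))) (at 0)"
    unfolding 3[symmetric] by (rule has_derivative_compose[OF 2]) (simp add: 1)
  then show ?thesis
    by (intro directional_deriv_eqI) (simp add: has_vector_derivative_def)
qed

text \<open>Passing from \<open>X\<close> to \<open>\<i> *s X\<close> replaces the coordinates (Re,
  Im) by (-Im, Re). Adding the two real Hessian terms therefore leaves, for each \<open>j\<close>,
  \<open>k\<close>, four times the real part of the Hermitian term.\<close>

lemma levi_form_eq:
  fixes \<rho> :: "complex ^ 'n::finite \<Rightarrow> real"
  assumes "open U" "p \<in> U" "\<And>x. x \<in> U \<Longrightarrow> GDERIV \<rho> x :> g x" and H: "(g has_derivative H) (at p)"
  shows "levi_form \<rho> p X = (H X \<bullet> X + H (\<i> *s X) \<bullet> (\<i> *s X)) / 4"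
proof -
  have lin: "linear H" using H has_derivative_linear by blast
  have W: "wirtinger_z j (wirtinger_zbar k (\<lambda>z. of_real (\<rho> z))) p =
     (Complex (H (axis j 1) \<bullet> axis k 1) (H (axis j 1) \<bullet> axis k \<i>) / 2
     - \<i> * (Complex (H (axis j \<i>) \<bullet> axis k 1) (H (axis j \<i>) \<bullet> axis k \<i>) / 2)) / 2" for j k
    unfolding wirtinger_z_def by (simp add: directional_deriv_wirtinger_zbar[OF assms])
  show ?thesis
    unfolding levi_form_def W Re_sum bilinear_complex_vec_expand[OF lin, of X X]
      bilinear_complex_vec_expand[OF lin, of "\<i> *s X" "\<i> *s X"] sum_divide_distrib sum.distrib[symmetric]
    by (intro sum.cong refl) (simp add: field_simps)
qed

text \<open>One complex equation is two real ones: the sum has real part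
  \<open>(X \<bullet> g) / 2\<close> and imaginary part
  \<open>- ((\<i> *s X) \<bullet> g) / 2\<close>. Complex tangent vectors thus form the largest
  complex subspace of the real tangent space.\<close>

lemma complex_tangent_iff:
  fixes \<rho> :: "complex ^ 'n::finite \<Rightarrow> real"
  assumes "GDERIV \<rho> p :> g"
  shows "complex_tangent \<rho> p X \<longleftrightarrow> X \<bullet> g = 0 \<and> (\<i> *s X) \<bullet> g = 0"
proof -
  have 1: "X \<bullet> g = (\<Sum>j\<in>UNIV. Re (X $ j) * (g \<bullet> axis j 1) + Im (X $ j) * (g \<bullet> axis j \<i>))" for X
    by (subst complex_vec_expand[of X]) (simp add: inner_sum_left inner_add_left inner_commute[of g])
  have "(\<Sum>j\<in>UNIV. wirtinger_z j (\<lambda>z. of_real (\<rho> z)) p * X $ j) = Complex (X \<bullet> g) (- ((\<i> *s X) \<bullet> g)) / 2"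
    unfolding wirtinger_z_of_real[OF assms] 1 complex_eq_iff
    by (auto simp: sum_divide_distrib sum_negf[symmetric] intro!: sum.cong)
  then show ?thesis by (auto simp: complex_tangent_def complex_eq_iff)
qed

section \<open>Curvatures and complex tangent vectors\<close>

text \<open>
  The sum runs over a basis of the maximal complex subspace of the hyperplane orthogonal to \<open>n\<close>. Since \<open>(\<i> b) \<bullet> v = - (b \<bullet> \<i> v)\<close>, Parseval applies to each, and only the
  components along \<open>n\<close> and \<open>\<i> n\<close> are lost.
\<close>

lemma sum_squares_complex_complement:
  fixes B :: "(complex ^ 'n::finite) set"
  assumes B: "pairwise orthogonal B" "\<And>x. x \<in> B \<Longrightarrow> norm x = 1" "span B = UNIV"
    and n: "n \<in> B" "\<i> *s n \<in> B" and v: "v \<bullet> n = 0"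
  shows "(\<Sum>b\<in>B - {n, \<i> *s n}. (b \<bullet> v)\<^sup>2 + ((\<i> *s b) \<bullet> v)\<^sup>2) = 2 * (v \<bullet> v - ((\<i> *s n) \<bullet> v)\<^sup>2)"
proof -
  have fin: "finite B" using B(1) by (rule pairwise_orthogonal_imp_finite)
  have "n \<noteq> \<i> *s n" using inner_i_self[of n] B(2)[OF n(1)] by (metis inner_eq_zero_iff norm_zero zero_neq_one)
  then have split: "(\<Sum>b\<in>B. F b) = F n + F (\<i> *s n) + (\<Sum>b\<in>B - {n, \<i> *s n}. F b)" for F :: "_ \<Rightarrow> real"
    using fin n sum.subset_diff[of "{n, \<i> *s n}" B F] by simp
  have 1: "(\<Sum>b\<in>B. (b \<bullet> v)\<^sup>2) = v \<bullet> v"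
    using parseval[OF B, of v v] by (simp add: power2_eq_square inner_commute)
  have "(\<Sum>b\<in>B. ((\<i> *s b) \<bullet> v)\<^sup>2) = (\<Sum>b\<in>B. ((\<i> *s v) \<bullet> b) * ((\<i> *s v) \<bullet> b))"
    by (simp add: inner_i_left[of _ v] power2_eq_square inner_commute[of "\<i> *s v"])
  also have "\<dots> = v \<bullet> v" using parseval[OF B, of "\<i> *s v" "\<i> *s v"] by (simp add: inner_i_i)
  finally have 2: "(\<Sum>b\<in>B. ((\<i> *s b) \<bullet> v)\<^sup>2) = v \<bullet> v" .
  have "n \<bullet> v = 0" using v by (simp add: inner_commute)
  \<comment> \<open>Each of the two full sums is \<open>v \<bullet> v\<close>. Removing
    \<open>n\<close> and \<open>\<i> *s n\<close> takes
    \<open>((\<i> *s n) \<bullet> v)\<^sup>2\<close> away from each, the other removed terms being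
    squares of \<open>n \<bullet> v = 0\<close>.\<close>
  then show ?thesis
    using 1 2 unfolding split by (simp add: i_i sum.distrib)
qed

text \<open>\<open>W\<close> and its image under multiplication by \<open>\<i>\<close> have the same
  dimension, more than half of the real dimension \<open>2 * CARD('n)\<close>, so they intersect
  nontrivially.\<close>

lemma complex_line_in_large_subspace:
  fixes W :: "(complex ^ 'n::finite) set"
  assumes W: "subspace W" and "CARD('n) < dim W"
  obtains X where "X \<noteq> 0" "X \<in> W" "\<i> *s X \<in> W"
proof -
  define J :: "complex ^ 'n \<Rightarrow> complex ^ 'n" where "J = (*s) \<i>"
  have lin: "linear J" unfolding J_def by (rule linear_i)
  have "inj J" by (rule injI) (simp add: J_def)
  then have "dim (J ` W) = dim W" using lin dim_image_eq by (metis inj_on_subset subset_UNIV)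
  moreover have "subspace (J ` W)" using lin W by (rule linear_subspace_image)
  moreover have "dim {x + y |x y. x \<in> W \<and> y \<in> J ` W} \<le> 2 * CARD('n)"
    using dim_subset_UNIV[of "{x + y |x y. x \<in> W \<and> y \<in> J ` W}"] by simp
  ultimately have "dim (W \<inter> J ` W) \<noteq> 0"
    using dim_sums_Int[OF W, of "J ` W"] assms(2) by linarith
  \<comment> \<open>The witness is the preimage \<open>X\<close> of \<open>Z\<close> under
    \<open>J\<close>: both \<open>X\<close> and \<open>\<i> *s X = Z\<close> lie in
    \<open>W\<close>.\<close>
  then obtain Z where "Z \<in> W \<inter> J ` W" "Z \<noteq> 0" by (auto simp: dim_eq_0)
  then show thesis using that by (auto simp: J_def)
qed

text \<open>
  \<open>q\<close> stands for the second fundamental form as a quadratic form, \<open>q X + q (\<i> X)\<close> for a positive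
  multiple of the Levi form.
\<close>

locale complex_hypersurface_form =
  fixes n :: "complex ^ 'n::finite" and e :: "nat \<Rightarrow> complex ^ 'n" and \<kappa> :: "nat \<Rightarrow> real"
    and I :: "nat set" and q :: "complex ^ 'n \<Rightarrow> real"
  assumes nz: "n \<noteq> 0" and tang: "\<And>i. i \<in> I \<Longrightarrow> e i \<bullet> n = 0"
    and orth: "\<And>i j. i \<in> I \<Longrightarrow> j \<in> I \<Longrightarrow> e i \<bullet> e j = (if i = j then 1 else 0)"
    and cardI: "card I = 2 * CARD('n) - 1"
    and q: "\<And>X. X \<bullet> n = 0 \<Longrightarrow> q X = (\<Sum>i\<in>I. \<kappa> i * (X \<bullet> e i)\<^sup>2)"
    and levi: "\<And>X. X \<bullet> n = 0 \<Longrightarrow> (\<i> *s X) \<bullet> n = 0 \<Longrightarrow> 0 \<le> q X + q (\<i> *s X)"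
begin

lemma finI: "finite I"
proof (rule ccontr)
  assume "infinite I"
  \<comment> \<open>An infinite set has \<open>card\<close> 0, while \<open>cardI\<close> makes the
    cardinality positive.\<close>
  then have "2 * CARD('n) - 1 = 0" using cardI by simp
  moreover have "CARD('n) \<ge> 1" by (simp add: Suc_leI)
  ultimately show False by linarith
qed

lemma expand: "X \<bullet> n = 0 \<Longrightarrow> (\<Sum>i\<in>I. (X \<bullet> e i) *\<^sub>R e i) = X"
  using nz tang orth cardI finI by (intro orthonormal_hyperplane_expand[where n = n]) auto

lemma ex_coefficient_nonzero:
  assumes "X \<bullet> n = 0" "X \<noteq> 0"
  shows "\<exists>i\<in>I. X \<bullet> e i \<noteq> 0"
  using expand[OF assms(1)] assms(2) by (metis (no_types, lifting) scaleR_zero_left sum.neutral)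

text \<open>Completing \<open>S\<close> to an orthonormal basis of the complex tangent space turns
  the left side into twice the trace of \<open>q\<close> there, that is, twice
  \<open>(\<Sum>i\<in>I. \<kappa> i) - q u\<close> with \<open>u\<close> the unit vector along
  \<open>\<i> *s n\<close>. Empty \<open>S\<close> gives non-negativity of the curvature sum, a
  singleton its positivity.\<close>

lemma sum_all_but_least:
  assumes S: "pairwise orthogonal S" "\<And>x. x \<in> S \<Longrightarrow> norm x = 1 \<and> x \<bullet> n = 0 \<and> (\<i> *s x) \<bullet> n = 0"
    and j: "j \<in> I" "\<And>i. i \<in> I \<Longrightarrow> \<kappa> j \<le> \<kappa> i"
  shows "(\<Sum>b\<in>S. q b + q (\<i> *s b)) \<le> 2 * (\<Sum>i\<in>I - {j}. \<kappa> i)"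
proof -
  define n' where "n' = n /\<^sub>R norm n"
  have n': "norm n' = 1" "n' \<bullet> n' = 1" using nz by (simp_all add: n'_def norm_eq_1 flip: power2_norm_eq_inner)
  have n'_iff: "X \<bullet> n' = 0 \<longleftrightarrow> X \<bullet> n = 0" for X using nz by (simp add: n'_def)
  have in'_iff: "X \<bullet> (\<i> *s n') = 0 \<longleftrightarrow> (\<i> *s X) \<bullet> n = 0" for X
    using n'_iff[of "\<i> *s X"] inner_i_left[of X n'] by simp
  define u where "u = \<i> *s n'"
  have u: "norm u = 1" "u \<bullet> u = 1" "u \<bullet> n' = 0" "u \<bullet> n = 0"
    using n' inner_i_self[of n'] n'_iff by (simp_all add: u_def inner_i_i norm_eq_1)
  have orth_S: "pairwise orthogonal (insert n' (insert u S))"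
    using S u in'_iff n'_iff by (auto simp: pairwise_insert orthogonal_def inner_commute u_def[symmetric])
  have norm_S: "norm x = 1" if "x \<in> insert n' (insert u S)" for x using that S n' u by auto
  obtain B where B: "insert n' (insert u S) \<subseteq> B" "pairwise orthogonal B" "\<And>x. x \<in> B \<Longrightarrow> norm x = 1" "span B = UNIV"
    using orthonormal_extension[OF orth_S norm_S] by blast
  have finB: "finite B" using B(2) by (rule pairwise_orthogonal_imp_finite)
  define B' where "B' = B - {n', u}"
  have B': "b \<bullet> n = 0" "(\<i> *s b) \<bullet> n = 0" if "b \<in> B'" for b
  proof -
    have "orthogonal b n'" "orthogonal b u"
      using that B(1,2) by (auto simp: B'_def pairwise_def)
    then show "b \<bullet> n = 0" "(\<i> *s b) \<bullet> n = 0"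
      using n'_iff in'_iff by (auto simp: orthogonal_def u_def)
  qed
  have "S \<subseteq> B'"
    using B(1) S(2) n'(2) u(2) n'_iff in'_iff u_def by (auto simp: B'_def) (metis zero_neq_one)+
  \<comment> \<open>Pseudoconvexity enters here: each basis vector added to \<open>S\<close>
    contributes a non-negative Levi term.\<close>
  then have "(\<Sum>b\<in>S. q b + q (\<i> *s b)) \<le> (\<Sum>b\<in>B'. q b + q (\<i> *s b))"
    using finB levi B' by (intro sum_mono2) (auto simp: B'_def)
  also have "\<dots> = (\<Sum>b\<in>B'. \<Sum>i\<in>I. \<kappa> i * ((b \<bullet> e i)\<^sup>2 + ((\<i> *s b) \<bullet> e i)\<^sup>2))"
    using B' by (intro sum.cong refl) (simp add: q distrib_left sum.distrib)
  also have "\<dots> = (\<Sum>i\<in>I. \<kappa> i * (\<Sum>b\<in>B'. (b \<bullet> e i)\<^sup>2 + ((\<i> *s b) \<bullet> e i)\<^sup>2))"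
    unfolding sum_distrib_left by (rule sum.swap)
  also have "\<dots> = (\<Sum>i\<in>I. \<kappa> i * (2 * (1 - (u \<bullet> e i)\<^sup>2)))"
  proof (intro sum.cong refl)
    fix i assume i: "i \<in> I"
    have "(\<Sum>b\<in>B'. (b \<bullet> e i)\<^sup>2 + ((\<i> *s b) \<bullet> e i)\<^sup>2) = 2 * (e i \<bullet> e i - (u \<bullet> e i)\<^sup>2)"
      unfolding B'_def u_def
      by (rule sum_squares_complex_complement) (use B tang[OF i] n'_iff u_def in auto)
    then show "\<kappa> i * (\<Sum>b\<in>B'. (b \<bullet> e i)\<^sup>2 + ((\<i> *s b) \<bullet> e i)\<^sup>2) = \<kappa> i * (2 * (1 - (u \<bullet> e i)\<^sup>2))"
      using orth[OF i i] by simp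
  qed
  also have "\<dots> = 2 * ((\<Sum>i\<in>I. \<kappa> i) - (\<Sum>i\<in>I. \<kappa> i * (u \<bullet> e i)\<^sup>2))"
    by (simp add: sum_subtractf[symmetric] sum_distrib_left algebra_simps)
  also have "\<dots> \<le> 2 * ((\<Sum>i\<in>I. \<kappa> i) - \<kappa> j)"
  proof -
    \<comment> \<open>The weights \<open>(u \<bullet> e i)\<^sup>2\<close> add up to
      \<open>u \<bullet> u = 1\<close>, so the weighted mean of the \<open>\<kappa> i\<close> is at
      least the least of them.\<close>
    have "(\<Sum>i\<in>I. (u \<bullet> e i)\<^sup>2) = u \<bullet> (\<Sum>i\<in>I. (u \<bullet> e i) *\<^sub>R e i)"
      by (simp add: inner_sum_right power2_eq_square)
    then have "\<kappa> j = (\<Sum>i\<in>I. \<kappa> j * (u \<bullet> e i)\<^sup>2)"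
      using expand[OF u(4)] u(2) by (simp add: sum_distrib_left[symmetric])
    also have "\<dots> \<le> (\<Sum>i\<in>I. \<kappa> i * (u \<bullet> e i)\<^sup>2)"
      using j by (intro sum_mono mult_right_mono) auto
    finally show ?thesis by simp
  qed
  also have "\<dots> = 2 * (\<Sum>i\<in>I - {j}. \<kappa> i)" using finI j by (simp add: sum.remove[of I j])
  finally show ?thesis .
qed

text \<open>The index \<open>j\<close> of a least curvature serves both claims, through
  \<open>sum_all_but_least\<close> with \<open>S = {}\<close> and with
  \<open>S = {Y}\<close>.\<close>

lemma ex_sum_all_but_one_nonneg:
  "\<exists>j\<in>I. 0 \<le> (\<Sum>i\<in>I - {j}. \<kappa> i) \<and>
     ((\<exists>X. X \<bullet> n = 0 \<and> (\<i> *s X) \<bullet> n = 0 \<and> q X + q (\<i> *s X) \<noteq> 0) \<longrightarrow> 0 < (\<Sum>i\<in>I - {j}. \<kappa> i))"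
proof -
  have "CARD('n) \<ge> 1" by (simp add: Suc_leI)
  then have "card I \<noteq> 0" using cardI by linarith
  then have "I \<noteq> {}" by auto
  then have "Min (\<kappa> ` I) \<in> \<kappa> ` I" using finI by (intro Min_in) auto
  then obtain j where j: "j \<in> I" "Min (\<kappa> ` I) = \<kappa> j" by blast
  have least: "\<kappa> j \<le> \<kappa> i" if "i \<in> I" for i
    using that finI j(2) Min_le[of "\<kappa> ` I" "\<kappa> i"] by simp
  have "0 < (\<Sum>i\<in>I - {j}. \<kappa> i)"
    if X: "X \<bullet> n = 0" "(\<i> *s X) \<bullet> n = 0" "q X + q (\<i> *s X) \<noteq> 0" for X
  proof -
    have scale: "q (c *\<^sub>R Y) = c\<^sup>2 * q Y" if "Y \<bullet> n = 0" for c Y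
      using that by (simp add: q power_mult_distrib sum_distrib_left mult_ac)
    have "X \<noteq> 0" using X(3) by (auto simp: q)
    \<comment> \<open>The set \<open>S\<close> has to consist of unit vectors; rescaling multiplies
      the Levi term by a positive square and keeps its sign.\<close>
    define Y where "Y = X /\<^sub>R norm X"
    have iY: "\<i> *s Y = (\<i> *s X) /\<^sub>R norm X" by (simp add: Y_def linear_cmul[OF linear_i])
    have "0 < q X + q (\<i> *s X)" using levi[OF X(1,2)] X(3) by simp
    then have "0 < (inverse (norm X))\<^sup>2 * (q X + q (\<i> *s X))" using \<open>X \<noteq> 0\<close> by (intro mult_pos_pos) auto
    also have "\<dots> = (\<Sum>b\<in>{Y}. q b + q (\<i> *s b))"
      using X by (simp add: iY scale distrib_left) (simp add: Y_def scale)
    also have "\<dots> \<le> 2 * (\<Sum>i\<in>I - {j}. \<kappa> i)"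
      using \<open>X \<noteq> 0\<close> X by (intro sum_all_but_least j least) (auto simp: iY, auto simp: Y_def)
    finally show ?thesis by simp
  qed
  moreover have "0 \<le> (\<Sum>i\<in>I - {j}. \<kappa> i)"
    using sum_all_but_least[of "{}" j] j least by simp
  ultimately show ?thesis using j(1) by blast
qed

text \<open>More than \<open>CARD('n)\<close> orthonormal vectors span a subspace large enough to
  contain both \<open>X\<close> and \<open>\<i> *s X\<close>; vectors of that span have no
  coefficient outside \<open>K\<close>.\<close>

lemma complex_line_in_span:
  assumes "K \<subseteq> I" "CARD('n) < card K"
  obtains X where "X \<noteq> 0" "X \<bullet> n = 0" "(\<i> *s X) \<bullet> n = 0"
    "\<And>i. i \<in> I - K \<Longrightarrow> X \<bullet> e i = 0 \<and> (\<i> *s X) \<bullet> e i = 0"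
proof -
  have "inj_on e K" "independent (e ` K)"
    using orth assms(1) orthonormal_family[of K e] by (auto simp: subset_iff)
  then have "dim (span (e ` K)) = card K" by (simp add: dim_eq_card_independent card_image)
  then obtain X where X: "X \<noteq> 0" "X \<in> span (e ` K)" "\<i> *s X \<in> span (e ` K)"
    using complex_line_in_large_subspace[of "span (e ` K)"] assms(2) by auto
  have perp: "Y \<bullet> v = 0" if "Y \<in> span (e ` K)" "\<And>i. i \<in> K \<Longrightarrow> e i \<bullet> v = 0" for Y v
  proof -
    have "orthogonal v Y"
      by (rule orthogonal_to_span[OF that(1)]) (use that(2) in \<open>auto simp: orthogonal_def inner_commute\<close>)
    then show ?thesis by (simp add: orthogonal_def inner_commute)
  qed
  have tangent: "Y \<bullet> n = 0" if "Y \<in> span (e ` K)" for Y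
    by (rule perp[OF that]) (use tang assms(1) in auto)
  have coeff: "Y \<bullet> e i = 0" if "Y \<in> span (e ` K)" "i \<in> I - K" for Y i
  proof (rule perp[OF that(1)])
    fix k assume "k \<in> K"
    then have "k \<in> I" "i \<in> I" "k \<noteq> i" using that(2) assms(1) by auto
    then show "e k \<bullet> e i = 0" using orth[of k i] by simp
  qed
  show thesis using that X tangent coeff by blast
qed

text \<open>Otherwise \<open>q\<close> is negative definite on the span of too many eigenvectors,
  and the Levi form is negative on a complex tangent vector in it.\<close>

lemma card_nonneg_ge: "CARD('n) - 1 \<le> card {i \<in> I. 0 \<le> \<kappa> i}"
proof (rule ccontr)
  assume *: "\<not> ?thesis"
  define K where "K = I - {i \<in> I. 0 \<le> \<kappa> i}"
  have "card K = card I - card {i \<in> I. 0 \<le> \<kappa> i}"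
    unfolding K_def using finI by (intro card_Diff_subset) auto
  \<comment> \<open>At least (2n - 1) - (n - 2) = n + 1 indices remain, where n stands for
    \<open>CARD('n)\<close>.\<close>
  then have "CARD('n) < card K" using * cardI by linarith
  moreover have "K \<subseteq> I" by (auto simp: K_def)
  ultimately obtain X where X: "X \<noteq> 0" "X \<bullet> n = 0" "(\<i> *s X) \<bullet> n = 0"
    "\<And>i. i \<in> I - K \<Longrightarrow> X \<bullet> e i = 0 \<and> (\<i> *s X) \<bullet> e i = 0"
    using complex_line_in_span by metis
  have neg: "q Y < 0" if Y: "Y \<noteq> 0" "Y \<bullet> n = 0" "\<And>i. i \<in> I - K \<Longrightarrow> Y \<bullet> e i = 0" for Y
  proof -
    obtain j where j: "j \<in> I" "Y \<bullet> e j \<noteq> 0" using ex_coefficient_nonzero Y by blast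
    then have "j \<in> K" using Y(3) by blast
    have "(\<Sum>i\<in>I. \<kappa> i * (Y \<bullet> e i)\<^sup>2) < (\<Sum>i\<in>I. 0)"
    proof (rule sum_strict_mono_ex1[OF finI])
      show "\<forall>i\<in>I. \<kappa> i * (Y \<bullet> e i)\<^sup>2 \<le> 0"
      proof
        fix i assume "i \<in> I"
        then show "\<kappa> i * (Y \<bullet> e i)\<^sup>2 \<le> 0"
          using Y(3)[of i] by (cases "i \<in> K") (auto simp: K_def mult_nonpos_nonneg)
      qed
      show "\<exists>i\<in>I. \<kappa> i * (Y \<bullet> e i)\<^sup>2 < 0"
        using j \<open>j \<in> K\<close> by (auto simp: K_def mult_less_0_iff intro!: bexI[of _ j])
    qed
    then show ?thesis using q[OF Y(2)] by simp
  qed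
  have "q X < 0" "q (\<i> *s X) < 0" using X by (auto intro!: neg)
  then show False using levi[OF X(2,3)] by simp
qed

text \<open>As for \<open>card_nonneg_ge\<close>, but \<open>K\<close> may contain zero curvatures,
  so \<open>q\<close> is only non-positive on the span; strict positivity of the Levi form supplies
  the contradiction.\<close>

lemma card_pos_ge:
  assumes strict: "\<And>X. X \<bullet> n = 0 \<Longrightarrow> (\<i> *s X) \<bullet> n = 0 \<Longrightarrow> X \<noteq> 0 \<Longrightarrow> 0 < q X + q (\<i> *s X)"
  shows "CARD('n) - 1 \<le> card {i \<in> I. 0 < \<kappa> i}"
proof (rule ccontr)
  assume *: "\<not> ?thesis"
  define K where "K = I - {i \<in> I. 0 < \<kappa> i}"
  have "card K = card I - card {i \<in> I. 0 < \<kappa> i}"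
    unfolding K_def using finI by (intro card_Diff_subset) auto
  then have "CARD('n) < card K" using * cardI by linarith
  moreover have "K \<subseteq> I" by (auto simp: K_def)
  ultimately obtain X where X: "X \<noteq> 0" "X \<bullet> n = 0" "(\<i> *s X) \<bullet> n = 0"
    "\<And>i. i \<in> I - K \<Longrightarrow> X \<bullet> e i = 0 \<and> (\<i> *s X) \<bullet> e i = 0"
    using complex_line_in_span by metis
  have nonpos: "q Y \<le> 0" if Y: "Y \<bullet> n = 0" "\<And>i. i \<in> I - K \<Longrightarrow> Y \<bullet> e i = 0" for Y
    unfolding q[OF Y(1)]
  proof (rule sum_nonpos)
    fix i assume "i \<in> I"
    then show "\<kappa> i * (Y \<bullet> e i)\<^sup>2 \<le> 0"
      using Y(2)[of i] by (cases "i \<in> K") (auto simp: K_def mult_nonpos_nonneg)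
  qed
  have "q X \<le> 0" "q (\<i> *s X) \<le> 0" using X by (auto intro!: nonpos)
  then show False using strict[OF X(2,3,1)] by simp
qed

end

section \<open>From the boundary to the algebraic setting\<close>

text \<open>Here \<open>n\<close> is the gradient and \<open>q\<close> the Hessian form divided by
  \<open>norm n\<close>. The constant \<open>c = 4 / norm n\<close> combines this normalisation with
  the factor 1/4 in the Levi form.\<close>

lemma boundary_hypersurface_form:
  fixes \<Omega> :: "(complex ^ 'n::finite) set"
  assumes w: "w \<in> frontier \<Omega>" and \<kappa>: "principal_curvatures \<Omega> w \<kappa>" and psc: "levi_pseudoconvex \<Omega>"
    and ldf: "local_defining_function \<Omega> w U \<rho>"
  obtains n e q c where "complex_hypersurface_form n e \<kappa> {1..2 * CARD('n) - 1} q"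
    and "\<And>X. complex_tangent \<rho> w X \<longleftrightarrow> X \<bullet> n = 0 \<and> (\<i> *s X) \<bullet> n = 0"
    and "c > 0" "\<And>X. q X + q (\<i> *s X) = c * levi_form \<rho> w X"
proof -
  have U: "open U" "w \<in> U" using ldf by (auto simp: local_defining_function_def)
  obtain g H where g: "\<And>x. x \<in> U \<Longrightarrow> GDERIV \<rho> x :> g x"
    and Hx: "\<And>x. x \<in> U \<Longrightarrow> (g has_derivative blinfun_apply (H x)) (at x)"
    using ldf unfolding local_defining_function_def C2_on_def by blast
  note H = Hx[OF U(2)]
  define n where "n = g w"
  have nz: "n \<noteq> 0" using ldf g[OF U(2)] w U by (auto simp: n_def local_defining_function_def)
  \<comment> \<open>Only the tangential part of \<open>f\<close> is the shape operator;
    \<open>f X\<close> may have a component along \<open>n\<close>, so eigenvector equations are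
    tested against tangent vectors alone.\<close>
  define f where "f X = H w X /\<^sub>R norm n" for X
  have lin: "linear f" unfolding f_def
    by (intro linearI) (simp_all add: blinfun.bilinear_simps algebra_simps)
  have sym: "f X \<bullet> Y = X \<bullet> f Y" for X Y
    using hessian_symmetric[OF U g H, of X Y] by (simp add: f_def)
  have tangent_eq: "boundary_tangent_space \<Omega> w = {X. X \<bullet> n = 0}"
    using boundary_tangent_space_eq[OF w ldf g[OF U(2)]] by (simp add: n_def)
  have II: "second_fundamental_form \<Omega> w X Y = f X \<bullet> Y" if "X \<bullet> n = 0" "Y \<bullet> n = 0" for X Y
    using second_fundamental_form_eq[OF w ldf g H] that by (simp add: n_def f_def divide_inverse mult.commute)
  define I where "I = {1..2 * CARD('n) - 1}"
  have "card {i \<in> I. \<kappa> i = c} = dim {X. X \<bullet> n = 0 \<and> (\<forall>Y. Y \<bullet> n = 0 \<longrightarrow> f X \<bullet> Y = c * (X \<bullet> Y))}" for c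
  proof -
    have "card {i \<in> I. \<kappa> i = c} = dim (curvature_eigenspace \<Omega> w c)"
      using \<kappa> by (simp add: principal_curvatures_def I_def mult.commute)
    also have "curvature_eigenspace \<Omega> w c = {X. X \<bullet> n = 0 \<and> (\<forall>Y. Y \<bullet> n = 0 \<longrightarrow> f X \<bullet> Y = c * (X \<bullet> Y))}"
      using II by (auto simp: curvature_eigenspace_def tangent_eq)
    finally show ?thesis .
  qed
  then obtain e where e: "\<And>i. i \<in> I \<Longrightarrow> e i \<bullet> n = 0"
    "\<And>i j. i \<in> I \<Longrightarrow> j \<in> I \<Longrightarrow> e i \<bullet> e j = (if i = j then 1 else 0)"
    "\<And>i Y. i \<in> I \<Longrightarrow> Y \<bullet> n = 0 \<Longrightarrow> f (e i) \<bullet> Y = \<kappa> i * (e i \<bullet> Y)"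
    using orthonormal_eigenbasis[OF lin sym, of I \<kappa> n] by (auto simp: I_def)
  define q where "q X = f X \<bullet> X" for X
  have q_sum: "q X = (\<Sum>i\<in>I. \<kappa> i * (X \<bullet> e i)\<^sup>2)" if X: "X \<bullet> n = 0" for X
  proof -
    have "(\<Sum>i\<in>I. (X \<bullet> e i) *\<^sub>R e i) = X"
      by (rule orthonormal_hyperplane_expand[OF nz e(1,2) _ _ X]) (auto simp: I_def)
    then have "q X = f (\<Sum>i\<in>I. (X \<bullet> e i) *\<^sub>R e i) \<bullet> X" by (simp add: q_def)
    also have "\<dots> = (\<Sum>i\<in>I. (X \<bullet> e i) * (f (e i) \<bullet> X))"
      by (simp add: linear_sum[OF lin] linear_cmul[OF lin] inner_sum_left)
    also have "\<dots> = (\<Sum>i\<in>I. \<kappa> i * (X \<bullet> e i)\<^sup>2)"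
      using e(3) X by (intro sum.cong refl) (simp add: power2_eq_square inner_commute)
    finally show ?thesis .
  qed
  have tangent: "complex_tangent \<rho> w X \<longleftrightarrow> X \<bullet> n = 0 \<and> (\<i> *s X) \<bullet> n = 0" for X
    using complex_tangent_iff[OF g[OF U(2)]] by (simp add: n_def)
  have levi: "q X + q (\<i> *s X) = 4 / norm n * levi_form \<rho> w X" for X
    using levi_form_eq[OF U g H, of X] nz by (simp add: q_def f_def field_simps)
  have "complex_hypersurface_form n e \<kappa> I q"
  proof
    show "0 \<le> q X + q (\<i> *s X)" if "X \<bullet> n = 0" "(\<i> *s X) \<bullet> n = 0" for X
      using psc w ldf that tangent unfolding levi levi_pseudoconvex_def by simp
  qed (use nz e(1,2) q_sum in \<open>auto simp: I_def\<close>)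
  then show thesis
    using nz by (intro that[OF _ tangent _ levi]) (simp_all add: I_def)
qed

theorem theorem0p4:
  fixes \<Omega> :: "(complex ^ 'n::finite) set" and w :: "complex ^ 'n" and \<kappa> :: "nat \<Rightarrow> real"
  assumes "open \<Omega>" and "connected \<Omega>" and "bounded \<Omega>"
    and "C2_boundary \<Omega>" and "levi_pseudoconvex \<Omega>"
    and "w \<in> frontier \<Omega>"
    and "principal_curvatures \<Omega> w \<kappa>"
  shows "(\<exists>j \<in> {1..2 * CARD('n) - 1}.
            0 \<le> (\<Sum>i \<in> {1..2 * CARD('n) - 1} - {j}. \<kappa> i) \<and>
            (\<not> levi_flat_at \<Omega> w \<longrightarrow> 0 < (\<Sum>i \<in> {1..2 * CARD('n) - 1} - {j}. \<kappa> i))) \<and>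
         CARD('n) - 1 \<le> card {i \<in> {1..2 * CARD('n) - 1}. 0 \<le> \<kappa> i} \<and>
         (strongly_pseudoconvex_at \<Omega> w \<longrightarrow>
            CARD('n) - 1 \<le> card {i \<in> {1..2 * CARD('n) - 1}. 0 < \<kappa> i})"
proof -
  \<comment> \<open>Flatness quantifies over all defining functions. If it fails, the defining
    function that witnesses the failure is used from here on, otherwise any one from
    \<open>C2_boundary\<close>.\<close>
  have "\<exists>U \<rho>. local_defining_function \<Omega> w U \<rho> \<and>
      (\<not> levi_flat_at \<Omega> w \<longrightarrow> (\<exists>X. complex_tangent \<rho> w X \<and> levi_form \<rho> w X \<noteq> 0))"
    using assms(4,6) unfolding C2_boundary_def levi_flat_at_def by blast
  then obtain U \<rho> where ldf: "local_defining_function \<Omega> w U \<rho>"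
    and not_flat: "\<not> levi_flat_at \<Omega> w \<Longrightarrow> \<exists>X. complex_tangent \<rho> w X \<and> levi_form \<rho> w X \<noteq> 0" by blast
  obtain n e q c where form: "complex_hypersurface_form n e \<kappa> {1..2 * CARD('n) - 1} q"
    and tangent: "\<And>X. complex_tangent \<rho> w X \<longleftrightarrow> X \<bullet> n = 0 \<and> (\<i> *s X) \<bullet> n = 0"
    and c: "c > 0" and levi_eq: "\<And>X. q X + q (\<i> *s X) = c * levi_form \<rho> w X"
    using boundary_hypersurface_form[OF assms(6,7,5) ldf] by metis
  interpret complex_hypersurface_form n e \<kappa> "{1..2 * CARD('n) - 1}" q by (rule form)
  have "\<exists>X. X \<bullet> n = 0 \<and> (\<i> *s X) \<bullet> n = 0 \<and> q X + q (\<i> *s X) \<noteq> 0" if "\<not> levi_flat_at \<Omega> w"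
    using not_flat[OF that] c tangent levi_eq by (metis mult_eq_0_iff less_irrefl)
  moreover have "0 < q X + q (\<i> *s X)"
    if "strongly_pseudoconvex_at \<Omega> w" "X \<bullet> n = 0" "(\<i> *s X) \<bullet> n = 0" "X \<noteq> 0" for X
    using that ldf c by (auto simp: levi_eq tangent strongly_pseudoconvex_at_def intro!: mult_pos_pos)
  ultimately show ?thesis
    using ex_sum_all_but_one_nonneg card_nonneg_ge card_pos_ge by blast
qed

end
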